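(* Let $X$ be a locale and let $R\rightarrowtail X\times X$ be a weakly closed localic equivalence relation with open cones. Then $R$ is the kernel pair of its quotient map $q\colon X\twoheadrightarrow X/R$, i.e. $R\cong X\times_{X/R}X$ as sublocales of $X\times X$.
   Context: Frames and locales. A frame is a complete lattice (order $\sqsubseteq$) in which $x\wedge\bigvee y_i=\bigvee (x\wedge y_i)$; frame maps preserve finite meets and all joins. The category of locales is the opposite of the category of frames: a locale $X$ has a frame of opens $\mathcal{O}X$, and a map $f\colon X\to Y$ is a frame map $f^{-1}\colon\mathcal{O}Y\to\mathcal{O}X$, with right adjoint $f_\ast$. A sublocale of $X$ is (an isomorphism class of) an extremal monomorphism $A\rightarrowtail X$, equivalently a map whose frame map is surjective; $A\subseteq B$ means the inclusion of $A$ factors (uniquely) through that of $B$. Weak closedness. Write $1$ for the terminal locale ($\mathcal{O}1$ is the initial frame, of truth values) and $!_X\colon X\to 1$ for the terminal map. A locale map $f\colon X\to Y$ is strongly dense if $f_\ast(!_X^{-1}(p))\sqsubseteq\, !_Y^{-1}(p)$ for all $p\in\mathcal{O}1$. A sublocale $A$ of $X$ is weakly closed if every strongly dense inclusion $A\subseteq B$ into a sublocale $B$ of $X$ is an isomorphism. Relations. A localic relation on $X$ is a sublocale $r\colon R\rightarrowtail X\times X$; its source and target maps are $s=\mathrm{pr}_1\circ r$, $t=\mathrm{pr}_2\circ r\colon R\to X$. A locale map $f\colon X\to Y$ is open if $f^{-1}$ has a left adjoint $f_!$ with $f_!(U\wedge f^{-1}(V))=f_!(U)\wedge V$. $R$ has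 open cones if $s,t$ are open. $\Delta$ denotes the diagonal relation $X\rightarrowtail X\times X$; $R^{\mathrm{op}}$ is the relation with source and target interchanged; the composite $R\circ R$ is the image sublocale of the map $(s\circ\pi_1,t\circ\pi_2)\colon R\times_X^{t,s}R\to X\times X$, with $\pi_1,\pi_2$ the projections of the pullback of $t$ (first factor) and $s$ (second factor). $R$ is an equivalence relation if $\Delta\subseteq R$, $R\circ R\subseteq R$ and $R=R^{\mathrm{op}}$. The quotient map $q\colon X\twoheadrightarrow X/R$ is the coequaliser of $s,t\colon R\to X$ in locales. The kernel pair of $q$ is the pullback $X\times_{X/R}X$ of $q$ along itself, a sublocale of $X\times X$ (the equaliser of $q\circ\mathrm{pr}_1$ and $q\circ\mathrm{pr}_2$). *)

theory Defs
  imports "HOL-Algebra.Complete_Lattice"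
begin

section \<open>Frames and locales\<close>

text \<open>
  A locale is represented by its frame of opens, a partially ordered structure with a carrier.
  A map of locales from X to Y is represented throughout by its inverse image, a function from the
  opens of Y to the opens of X.  Only the values of such functions on carriers are relevant.
\<close>

locale frame = complete_lattice L for L :: "'a gorder" (structure) +
  assumes meet_sup_distrib:
    "x \<in> carrier L \<Longrightarrow> A \<subseteq> carrier L \<Longrightarrow> x \<sqinter> \<Squnion>A = \<Squnion>((\<lambda>y. x \<sqinter> y) ` A)"

definition frame_map :: "'a gorder \<Rightarrow> 'b gorder \<Rightarrow> ('a \<Rightarrow> 'b) \<Rightarrow> bool" where
  "frame_map L M f \<longleftrightarrow>
     f \<in> carrier L \<rightarrow> carrier M \<and>
     f \<top>\<^bsub>L\<^esub> = \<top>\<^bsub>M\<^esub> \<and>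
     (\<forall>x\<in>carrier L. \<forall>y\<in>carrier L. f (x \<sqinter>\<^bsub>L\<^esub> y) = f x \<sqinter>\<^bsub>M\<^esub> f y) \<and>
     (\<forall>A. A \<subseteq> carrier L \<longrightarrow> f (\<Squnion>\<^bsub>L\<^esub>A) = \<Squnion>\<^bsub>M\<^esub>(f ` A))"

definition locale_map :: "'a gorder \<Rightarrow> 'b gorder \<Rightarrow> ('b \<Rightarrow> 'a) \<Rightarrow> bool" where
  "locale_map X Y f \<longleftrightarrow> frame_map Y X f"

definition locale_iso :: "'a gorder \<Rightarrow> 'b gorder \<Rightarrow> ('b \<Rightarrow> 'a) \<Rightarrow> bool" where
  "locale_iso X Y f \<longleftrightarrow> locale_map X Y f \<and>
     (\<exists>g. locale_map Y X g \<and> (\<forall>V\<in>carrier Y. g (f V) = V) \<and> (\<forall>U\<in>carrier X. f (g U) = U))"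

definition direct_image :: "'a gorder \<Rightarrow> 'b gorder \<Rightarrow> ('b \<Rightarrow> 'a) \<Rightarrow> 'a \<Rightarrow> 'b" where
  "direct_image X Y f U = \<Squnion>\<^bsub>Y\<^esub>{V \<in> carrier Y. f V \<sqsubseteq>\<^bsub>X\<^esub> U}"

definition open_locale_map :: "'a gorder \<Rightarrow> 'b gorder \<Rightarrow> ('b \<Rightarrow> 'a) \<Rightarrow> bool" where
  "open_locale_map X Y f \<longleftrightarrow> locale_map X Y f \<and>
     (\<exists>e. e \<in> carrier X \<rightarrow> carrier Y \<and>
        (\<forall>U\<in>carrier X. \<forall>V\<in>carrier Y. e U \<sqsubseteq>\<^bsub>Y\<^esub> V \<longleftrightarrow> U \<sqsubseteq>\<^bsub>X\<^esub> f V) \<and>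
        (\<forall>U\<in>carrier X. \<forall>V\<in>carrier Y. e (U \<sqinter>\<^bsub>X\<^esub> f V) = e U \<sqinter>\<^bsub>Y\<^esub> V))"

text \<open>The frame of truth values, and the unique locale map from X to 1 (see \<open>terminal_map\<close> below).\<close>

definition terminal_locale :: "bool gorder" where
  "terminal_locale = \<lparr>carrier = UNIV, eq = (=), le = (\<le>)\<rparr>"

definition terminal_map :: "'a gorder \<Rightarrow> bool \<Rightarrow> 'a" where
  "terminal_map X p = (if p then \<top>\<^bsub>X\<^esub> else \<bottom>\<^bsub>X\<^esub>)"


section \<open>Sublocales\<close>

text \<open>
  A sublocale of X is given by its own frame of opens together with the inverse image of the
  inclusion; two such pairs are identified by \<open>sub_eq\<close>, isomorphism over X.
\<close>

type_synonym ('x, 'a) subloc = "'a gorder \<times> ('x \<Rightarrow> 'a)"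

definition is_sublocale :: "'x gorder \<Rightarrow> ('x, 'a) subloc \<Rightarrow> bool" where
  "is_sublocale X A \<longleftrightarrow> frame (fst A) \<and> locale_map (fst A) X (snd A) \<and>
     snd A ` carrier X = carrier (fst A)"

definition sub_inclusion ::
  "'x gorder \<Rightarrow> ('x, 'a) subloc \<Rightarrow> ('x, 'b) subloc \<Rightarrow> ('b \<Rightarrow> 'a) \<Rightarrow> bool" where
  "sub_inclusion X A B i \<longleftrightarrow> locale_map (fst A) (fst B) i \<and>
     (\<forall>U\<in>carrier X. i (snd B U) = snd A U)"

definition sub_le :: "'x gorder \<Rightarrow> ('x, 'a) subloc \<Rightarrow> ('x, 'b) subloc \<Rightarrow> bool" where
  "sub_le X A B \<longleftrightarrow> (\<exists>i. sub_inclusion X A B i)"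

definition sub_eq :: "'x gorder \<Rightarrow> ('x, 'a) subloc \<Rightarrow> ('x, 'b) subloc \<Rightarrow> bool" where
  "sub_eq X A B \<longleftrightarrow> (\<exists>i. sub_inclusion X A B i \<and> locale_iso (fst A) (fst B) i)"

definition strongly_dense :: "'a gorder \<Rightarrow> 'b gorder \<Rightarrow> ('b \<Rightarrow> 'a) \<Rightarrow> bool" where
  "strongly_dense X Y f \<longleftrightarrow>
     (\<forall>p\<in>carrier terminal_locale.
        direct_image X Y f (terminal_map X p) \<sqsubseteq>\<^bsub>Y\<^esub> terminal_map Y p)"

text \<open>
  The sublocales \<open>B\<close> below have their opens in the type of the opens of X.  Up to isomorphism every
  sublocale of X is of this form, see \<open>weakly_closed_any_type\<close>.
\<close>

definition weakly_closed :: "'x gorder \<Rightarrow> ('x, 'a) subloc \<Rightarrow> bool" where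
  "weakly_closed X A \<longleftrightarrow>
     (\<forall>(B :: ('x, 'x) subloc) i.
        is_sublocale X B \<and> sub_inclusion X A B i \<and> strongly_dense (fst A) (fst B) i \<longrightarrow>
        locale_iso (fst A) (fst B) i)"

text \<open>The image of a locale map f from A to X.\<close>

definition image_sub :: "'x gorder \<Rightarrow> 'a gorder \<Rightarrow> ('x \<Rightarrow> 'a) \<Rightarrow> ('x, 'a) subloc" where
  "image_sub X A f = (A\<lparr>carrier := f ` carrier X\<rparr>, f)"


section \<open>Limits and colimits of locales\<close>

text \<open>
  The frame of opens of the product of X and Y is the frame coproduct, realised by the sets of
  rectangles that are down-closed and closed under joins in each coordinate.
\<close>

definition product_open :: "'a gorder \<Rightarrow> 'b gorder \<Rightarrow> ('a \<times> 'b) set \<Rightarrow> bool" where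
  "product_open X Y D \<longleftrightarrow> D \<subseteq> carrier X \<times> carrier Y \<and>
     (\<forall>a\<in>carrier X. \<forall>b\<in>carrier Y. \<forall>a'\<in>carrier X. \<forall>b'\<in>carrier Y.
        (a, b) \<in> D \<longrightarrow> a' \<sqsubseteq>\<^bsub>X\<^esub> a \<longrightarrow> b' \<sqsubseteq>\<^bsub>Y\<^esub> b \<longrightarrow> (a', b') \<in> D) \<and>
     (\<forall>A b. A \<subseteq> carrier X \<longrightarrow> b \<in> carrier Y \<longrightarrow> A \<times> {b} \<subseteq> D \<longrightarrow> (\<Squnion>\<^bsub>X\<^esub>A, b) \<in> D) \<and>
     (\<forall>a B. a \<in> carrier X \<longrightarrow> B \<subseteq> carrier Y \<longrightarrow> {a} \<times> B \<subseteq> D \<longrightarrow> (a, \<Squnion>\<^bsub>Y\<^esub>B) \<in> D)"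

definition product :: "'a gorder \<Rightarrow> 'b gorder \<Rightarrow> ('a \<times> 'b) set gorder" where
  "product X Y = \<lparr>carrier = {D. product_open X Y D}, eq = (=), le = (\<subseteq>)\<rparr>"

definition rectangle :: "'a gorder \<Rightarrow> 'b gorder \<Rightarrow> 'a \<Rightarrow> 'b \<Rightarrow> ('a \<times> 'b) set" where
  "rectangle X Y U V = {(a, b) \<in> carrier X \<times> carrier Y.
     (a \<sqsubseteq>\<^bsub>X\<^esub> U \<and> b \<sqsubseteq>\<^bsub>Y\<^esub> V) \<or> a = \<bottom>\<^bsub>X\<^esub> \<or> b = \<bottom>\<^bsub>Y\<^esub>}"

definition pr1 :: "'a gorder \<Rightarrow> 'b gorder \<Rightarrow> 'a \<Rightarrow> ('a \<times> 'b) set" where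
  "pr1 X Y U = rectangle X Y U \<top>\<^bsub>Y\<^esub>"

definition pr2 :: "'a gorder \<Rightarrow> 'b gorder \<Rightarrow> 'b \<Rightarrow> ('a \<times> 'b) set" where
  "pr2 X Y V = rectangle X Y \<top>\<^bsub>X\<^esub> V"

definition pairing ::
  "'z gorder \<Rightarrow> ('a \<Rightarrow> 'z) \<Rightarrow> ('b \<Rightarrow> 'z) \<Rightarrow> ('a \<times> 'b) set \<Rightarrow> 'z" where
  "pairing Z f g D = \<Squnion>\<^bsub>Z\<^esub>{f a \<sqinter>\<^bsub>Z\<^esub> g b | a b. (a, b) \<in> D}"

text \<open>
  The equaliser of two locale maps f, g from Z to Y: its opens are the elements of Z that do not
  distinguish the inverse images under f and g, and the inverse image of the inclusion is the
  associated closure operator (a nucleus).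
\<close>

definition equaliser_opens :: "'z gorder \<Rightarrow> 'y gorder \<Rightarrow> ('y \<Rightarrow> 'z) \<Rightarrow> ('y \<Rightarrow> 'z) \<Rightarrow> 'z set" where
  "equaliser_opens Z Y f g = {z \<in> carrier Z. \<forall>V\<in>carrier Y. \<forall>w\<in>carrier Z.
     w \<sqinter>\<^bsub>Z\<^esub> f V \<sqsubseteq>\<^bsub>Z\<^esub> z \<longleftrightarrow> w \<sqinter>\<^bsub>Z\<^esub> g V \<sqsubseteq>\<^bsub>Z\<^esub> z}"

definition equaliser ::
  "'z gorder \<Rightarrow> 'y gorder \<Rightarrow> ('y \<Rightarrow> 'z) \<Rightarrow> ('y \<Rightarrow> 'z) \<Rightarrow> ('z, 'z) subloc" where
  "equaliser Z Y f g =
     (Z\<lparr>carrier := equaliser_opens Z Y f g\<rparr>,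
      \<lambda>z. \<Sqinter>\<^bsub>Z\<^esub>{s \<in> equaliser_opens Z Y f g. z \<sqsubseteq>\<^bsub>Z\<^esub> s})"

text \<open>
  The pullback of locale maps f from A to Y and g from B to Y, as a sublocale of the product of
  A and B.
\<close>

definition pullback ::
  "'a gorder \<Rightarrow> 'b gorder \<Rightarrow> 'y gorder \<Rightarrow> ('y \<Rightarrow> 'a) \<Rightarrow> ('y \<Rightarrow> 'b) \<Rightarrow>
   (('a \<times> 'b) set, ('a \<times> 'b) set) subloc" where
  "pullback A B Y f g = equaliser (product A B) Y (pr1 A B \<circ> f) (pr2 A B \<circ> g)"

definition kernel_pair ::
  "'x gorder \<Rightarrow> 'y gorder \<Rightarrow> ('y \<Rightarrow> 'x) \<Rightarrow> (('x \<times> 'x) set, ('x \<times> 'x) set) subloc" where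
  "kernel_pair X Y q = pullback X X Y q q"

text \<open>
  The coequaliser of locale maps s, t from R to X: its frame of opens is the equaliser in frames of
  the inverse images, a subframe of the opens of X, and the inverse image of the coequalising map
  is the inclusion of that subframe.
\<close>

definition coequaliser ::
  "'x gorder \<Rightarrow> ('x \<Rightarrow> 'r) \<Rightarrow> ('x \<Rightarrow> 'r) \<Rightarrow> 'x gorder \<times> ('x \<Rightarrow> 'x)" where
  "coequaliser X s t = (X\<lparr>carrier := {U \<in> carrier X. s U = t U}\<rparr>, \<lambda>U. U)"


section \<open>Localic relations\<close>

type_synonym ('x, 'r) locrel = "(('x \<times> 'x) set, 'r) subloc"

definition localic_relation :: "'x gorder \<Rightarrow> ('x, 'r) locrel \<Rightarrow> bool" where
  "localic_relation X R \<longleftrightarrow> is_sublocale (product X X) R"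

definition rel_source :: "'x gorder \<Rightarrow> ('x, 'r) locrel \<Rightarrow> 'x \<Rightarrow> 'r" where
  "rel_source X R = snd R \<circ> pr1 X X"

definition rel_target :: "'x gorder \<Rightarrow> ('x, 'r) locrel \<Rightarrow> 'x \<Rightarrow> 'r" where
  "rel_target X R = snd R \<circ> pr2 X X"

definition open_cones :: "'x gorder \<Rightarrow> ('x, 'r) locrel \<Rightarrow> bool" where
  "open_cones X R \<longleftrightarrow>
     open_locale_map (fst R) X (rel_source X R) \<and> open_locale_map (fst R) X (rel_target X R)"

definition diagonal :: "'x gorder \<Rightarrow> ('x, 'x) locrel" where
  "diagonal X = (X, pairing X (\<lambda>U. U) (\<lambda>U. U))"

definition rel_op :: "'x gorder \<Rightarrow> ('x, 'r) locrel \<Rightarrow> ('x, 'r) locrel" where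
  "rel_op X R = (fst R, pairing (fst R) (rel_target X R) (rel_source X R))"

definition rel_comp :: "'x gorder \<Rightarrow> ('x, 'r) locrel \<Rightarrow> ('x, ('r \<times> 'r) set) locrel" where
  "rel_comp X R =
     (let P = pullback (fst R) (fst R) X (rel_target X R) (rel_source X R);
          p1 = snd P \<circ> pr1 (fst R) (fst R);
          p2 = snd P \<circ> pr2 (fst R) (fst R)
      in image_sub (product X X) (fst P)
           (pairing (fst P) (p1 \<circ> rel_source X R) (p2 \<circ> rel_target X R)))"

definition localic_equivalence :: "'x gorder \<Rightarrow> ('x, 'r) locrel \<Rightarrow> bool" where
  "localic_equivalence X R \<longleftrightarrow> localic_relation X R \<and>
     sub_le (product X X) (diagonal X) R \<and>
     sub_le (product X X) (rel_comp X R) R \<and>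
     sub_eq (product X X) R (rel_op X R)"

definition quotient_locale :: "'x gorder \<Rightarrow> ('x, 'r) locrel \<Rightarrow> 'x gorder" where
  "quotient_locale X R = fst (coequaliser X (rel_source X R) (rel_target X R))"

definition quotient_map :: "'x gorder \<Rightarrow> ('x, 'r) locrel \<Rightarrow> 'x \<Rightarrow> 'x" where
  "quotient_map X R = snd (coequaliser X (rel_source X R) (rel_target X R))"


section \<open>The constructions have their universal properties\<close>

subsection \<open>Frames\<close>

lemma frameI:
  fixes L :: "'a gorder" (structure)
  assumes po: "partial_order L"
    and S_closed: "\<And>A. A \<subseteq> carrier L \<Longrightarrow> S A \<in> carrier L"
    and S_upper: "\<And>A x. A \<subseteq> carrier L \<Longrightarrow> x \<in> A \<Longrightarrow> x \<sqsubseteq> S A"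
    and S_least: "\<And>A z. A \<subseteq> carrier L \<Longrightarrow> z \<in> carrier L \<Longrightarrow> (\<And>x. x \<in> A \<Longrightarrow> x \<sqsubseteq> z) \<Longrightarrow> S A \<sqsubseteq> z"
    and M_closed: "\<And>x y. x \<in> carrier L \<Longrightarrow> y \<in> carrier L \<Longrightarrow> M x y \<in> carrier L"
    and M_left: "\<And>x y. x \<in> carrier L \<Longrightarrow> y \<in> carrier L \<Longrightarrow> M x y \<sqsubseteq> x"
    and M_right: "\<And>x y. x \<in> carrier L \<Longrightarrow> y \<in> carrier L \<Longrightarrow> M x y \<sqsubseteq> y"
    and M_greatest: "\<And>x y z. x \<in> carrier L \<Longrightarrow> y \<in> carrier L \<Longrightarrow> z \<in> carrier L \<Longrightarrow>
        z \<sqsubseteq> x \<Longrightarrow> z \<sqsubseteq> y \<Longrightarrow> z \<sqsubseteq> M x y"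
    and dist: "\<And>x A. x \<in> carrier L \<Longrightarrow> A \<subseteq> carrier L \<Longrightarrow> M x (S A) \<sqsubseteq> S (M x ` A)"
  shows "frame L"
    and "\<And>A. A \<subseteq> carrier L \<Longrightarrow> \<Squnion>A = S A"
    and "\<And>x y. x \<in> carrier L \<Longrightarrow> y \<in> carrier L \<Longrightarrow> x \<sqinter> y = M x y"
proof -
  interpret partial_order L by (rule po)
  have lub: "least L (S A) (Upper L A)" if "A \<subseteq> carrier L" for A
  proof (rule least_UpperI[OF S_upper[OF that] _ that S_closed[OF that]])
    show "S A \<sqsubseteq> y" if "y \<in> Upper L A" for y
      using that \<open>A \<subseteq> carrier L\<close> by (intro S_least) (auto simp: Upper_def)
  qed
  have glb: "greatest L (S (Lower L A)) (Lower L A)" if A: "A \<subseteq> carrier L" for A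
  proof (rule greatest_LowerI)
    show "S (Lower L A) \<sqsubseteq> x" if "x \<in> A" for x
      using that A by (intro S_least) (auto simp: Lower_def)
    show "y \<sqsubseteq> S (Lower L A)" if "y \<in> Lower L A" for y
      by (rule S_upper[OF Lower_closed that])
    show "S (Lower L A) \<in> carrier L"
      by (rule S_closed[OF Lower_closed])
  qed (rule A)
  have cl: "complete_lattice L"
    by (rule complete_latticeI) (use lub glb in blast)+
  then interpret complete_lattice L .
  show sup: "\<Squnion>A = S A" if "A \<subseteq> carrier L" for A
    using lub[OF that] sup_lub[OF that] least_unique by blast
  show meet: "x \<sqinter> y = M x y" if x: "x \<in> carrier L" and y: "y \<in> carrier L" for x y
  proof (rule le_antisym)
    show "x \<sqinter> y \<sqsubseteq> M x y"
      using x y by (intro M_greatest) (auto simp: meet_left meet_right)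
    show "M x y \<sqsubseteq> x \<sqinter> y"
      using x y by (intro meet_le) (auto simp: M_left M_right M_closed)
  qed (use x y M_closed in auto)
  show "frame L"
  proof (intro frame.intro[OF cl] frame_axioms.intro)
    fix x A assume x: "x \<in> carrier L" and A: "A \<subseteq> carrier L"
    have im: "(\<lambda>y. x \<sqinter> y) ` A = M x ` A"
      using x A by (intro image_cong) (auto simp: meet subset_iff)
    have MA: "M x ` A \<subseteq> carrier L"
      using x A M_closed by auto
    have "M x (S A) = S (M x ` A)"
    proof (rule le_antisym)
      show "M x (S A) \<sqsubseteq> S (M x ` A)"
        by (rule dist[OF x A])
      show "S (M x ` A) \<sqsubseteq> M x (S A)"
      proof (rule S_least[OF MA])
        fix z assume "z \<in> M x ` A"
        then obtain y where y: "y \<in> A" "z = M x y" by blast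
        have yc: "y \<in> carrier L" using y A by blast
        show "z \<sqsubseteq> M x (S A)"
          unfolding y using x yc y A
          by (meson M_closed M_greatest M_left M_right S_closed S_upper le_trans)
      qed (use x A S_closed M_closed in auto)
    qed (use x A MA S_closed M_closed in auto)
    then show "x \<sqinter> \<Squnion>A = \<Squnion>((\<lambda>y. x \<sqinter> y) ` A)"
      using x A MA by (simp add: im meet sup S_closed)
  qed
qed

lemma top_eqI:
  assumes "frame L" "t \<in> carrier L" "\<And>x. x \<in> carrier L \<Longrightarrow> x \<sqsubseteq>\<^bsub>L\<^esub> t"
  shows "\<top>\<^bsub>L\<^esub> = t"
proof -
  interpret frame L by fact
  show ?thesis using assms by (metis le_antisym top_closed top_higher)
qed

lemma bottom_eqI:
  assumes "frame L" "t \<in> carrier L" "\<And>x. x \<in> carrier L \<Longrightarrow> t \<sqsubseteq>\<^bsub>L\<^esub> x"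
  shows "\<bottom>\<^bsub>L\<^esub> = t"
proof -
  interpret frame L by fact
  show ?thesis using assms by (metis le_antisym bottom_closed bottom_lower)
qed

text \<open>With these library rules in the claset, classical search tends to diverge.\<close>

declare (in frame) le_antisym [rule del] le_cong_l [rule del] le_cong_r [rule del]
  weak_refl [rule del] LFP_fixed_point [rule del] GFP_fixed_point [rule del]
  is_closed_eq [rule del] is_closed_eq_rev [rule del] Upper_elemD [rule del]

context frame
begin

lemma sup_empty_eq: "\<Squnion>{} = \<bottom>"
  using weak_sup_empty by (simp add: eq_is_equal)

lemma sup_eqI:
  assumes "A \<subseteq> carrier L" "s \<in> carrier L" "\<And>x. x \<in> A \<Longrightarrow> x \<sqsubseteq> s"
    and "\<And>z. z \<in> carrier L \<Longrightarrow> (\<And>x. x \<in> A \<Longrightarrow> x \<sqsubseteq> z) \<Longrightarrow> s \<sqsubseteq> z"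
  shows "\<Squnion>A = s"
proof (rule le_antisym)
  show "\<Squnion>A \<sqsubseteq> s" by (rule sup_least[OF assms(1-3)])
  show "s \<sqsubseteq> \<Squnion>A" by (rule assms(4)[OF sup_closed[OF assms(1)] sup_upper[OF assms(1)]])
qed (use assms in simp_all)

lemma le_bottom_eq: "x \<in> carrier L \<Longrightarrow> x \<sqsubseteq> \<bottom> \<Longrightarrow> x = \<bottom>"
  by (rule le_antisym) simp_all

lemma le_iff_meet_eq: "x \<in> carrier L \<Longrightarrow> y \<in> carrier L \<Longrightarrow> x \<sqsubseteq> y \<longleftrightarrow> x \<sqinter> y = x"
  using le_iff_join[of x y] by metis

lemma meet_sup_le_iff:
  assumes "x \<in> carrier L" "A \<subseteq> carrier L" "z \<in> carrier L"
  shows "x \<sqinter> \<Squnion>A \<sqsubseteq> z \<longleftrightarrow> (\<forall>y\<in>A. x \<sqinter> y \<sqsubseteq> z)"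
proof -
  have c: "(\<lambda>y. x \<sqinter> y) ` A \<subseteq> carrier L" using assms by auto
  show ?thesis
  proof
    assume l: "x \<sqinter> \<Squnion>A \<sqsubseteq> z"
    show "\<forall>y\<in>A. x \<sqinter> y \<sqsubseteq> z"
    proof
      fix y assume y: "y \<in> A"
      have "x \<sqinter> y \<sqsubseteq> \<Squnion>((\<lambda>y. x \<sqinter> y) ` A)"
        using c y by (intro sup_upper) auto
      then show "x \<sqinter> y \<sqsubseteq> z"
        using l assms c y meet_sup_distrib[of x A] by (metis (no_types, lifting) image_eqI le_trans subsetD sup_closed)
    qed
  next
    assume "\<forall>y\<in>A. x \<sqinter> y \<sqsubseteq> z"
    then show "x \<sqinter> \<Squnion>A \<sqsubseteq> z"
      using assms c by (auto simp: meet_sup_distrib intro!: sup_least)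
  qed
qed

end

lemma frame_map_closed: "frame_map L M f \<Longrightarrow> x \<in> carrier L \<Longrightarrow> f x \<in> carrier M"
  unfolding frame_map_def by blast

lemma frame_map_top: "frame_map L M f \<Longrightarrow> f \<top>\<^bsub>L\<^esub> = \<top>\<^bsub>M\<^esub>"
  unfolding frame_map_def by blast

lemma frame_map_meet:
  "frame_map L M f \<Longrightarrow> x \<in> carrier L \<Longrightarrow> y \<in> carrier L \<Longrightarrow> f (x \<sqinter>\<^bsub>L\<^esub> y) = f x \<sqinter>\<^bsub>M\<^esub> f y"
  unfolding frame_map_def by blast

lemma frame_map_sup:
  "frame_map L M f \<Longrightarrow> A \<subseteq> carrier L \<Longrightarrow> f (\<Squnion>\<^bsub>L\<^esub>A) = \<Squnion>\<^bsub>M\<^esub>(f ` A)"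
  unfolding frame_map_def by blast

lemma frame_map_bottom: "frame L \<Longrightarrow> frame M \<Longrightarrow> frame_map L M f \<Longrightarrow> f \<bottom>\<^bsub>L\<^esub> = \<bottom>\<^bsub>M\<^esub>"
  using frame_map_sup[of L M f "{}"] frame.sup_empty_eq[of L] frame.sup_empty_eq[of M] by simp

lemma frame_map_mono:
  assumes "frame L" "frame M" "frame_map L M f" "x \<in> carrier L" "y \<in> carrier L" "x \<sqsubseteq>\<^bsub>L\<^esub> y"
  shows "f x \<sqsubseteq>\<^bsub>M\<^esub> f y"
  using assms frame.le_iff_meet_eq[of L x y] frame.le_iff_meet_eq[of M "f x" "f y"]
    frame_map_closed[of L M f] frame_map_meet[of L M f x y] by simp

lemma frame_map_comp:
  assumes "frame_map L M f" "frame_map M N g"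
  shows "frame_map L N (g \<circ> f)"
proof -
  have "f ` A \<subseteq> carrier M" if "A \<subseteq> carrier L" for A
    using that assms(1) frame_map_closed by fastforce
  then show ?thesis
    using assms unfolding frame_map_def by (auto simp: image_comp Pi_iff)
qed

lemma frame_terminal_locale: "frame terminal_locale"
proof -
  have "partial_order terminal_locale"
    by unfold_locales (auto simp: terminal_locale_def)
  then show ?thesis
    by (rule frameI(1)[where S = "\<lambda>A. True \<in> A" and M = "(\<and>)"])
      (auto simp: terminal_locale_def le_bool_def)
qed

lemma terminal_locale_simps:
  "\<top>\<^bsub>terminal_locale\<^esub> = True" "\<bottom>\<^bsub>terminal_locale\<^esub> = False"
  "a \<sqinter>\<^bsub>terminal_locale\<^esub> b \<longleftrightarrow> a \<and> b" "\<Squnion>\<^bsub>terminal_locale\<^esub>A \<longleftrightarrow> True \<in> A"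
proof -
  interpret frame terminal_locale by (rule frame_terminal_locale)
  have po: "partial_order terminal_locale" by unfold_locales
  show "\<top>\<^bsub>terminal_locale\<^esub> = True" "\<bottom>\<^bsub>terminal_locale\<^esub> = False"
    by (intro top_eqI bottom_eqI frame_terminal_locale; simp add: terminal_locale_def)+
  show "a \<sqinter>\<^bsub>terminal_locale\<^esub> b \<longleftrightarrow> a \<and> b" "\<Squnion>\<^bsub>terminal_locale\<^esub>A \<longleftrightarrow> True \<in> A"
    by (rule frameI(2,3)[OF po, where S = "\<lambda>A. True \<in> A" and M = "(\<and>)"];
        auto simp: terminal_locale_def le_bool_def)+
qed

lemma terminal_map:
  fixes X :: "'a gorder" (structure)
  assumes "frame X"
  shows "locale_map X terminal_locale (terminal_map X)"
    and "locale_map X terminal_locale f \<Longrightarrow> f p = terminal_map X p"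
proof -
  interpret frame X by fact
  have "terminal_map X (True \<in> A) = \<Squnion>(terminal_map X ` A)" for A
    by (rule sup_eqI[symmetric]) (auto simp: terminal_map_def image_iff intro: bexI[of _ True])
  moreover have "\<top> \<sqinter> \<top> = \<top>" "\<top> \<sqinter> \<bottom> = \<bottom>" "\<bottom> \<sqinter> \<top> = \<bottom>" "\<bottom> \<sqinter> \<bottom> = \<bottom>"
    using le_iff_meet_eq[of \<top> \<top>] le_iff_meet_eq[of \<bottom> \<top>] le_iff_meet_eq[of \<bottom> \<bottom>]
    by (auto simp: meet_comm[of X \<top> \<bottom>] intro: top_higher)
  ultimately show "locale_map X terminal_locale (terminal_map X)"
    unfolding locale_map_def frame_map_def terminal_locale_simps
    by (auto simp: terminal_map_def terminal_locale_def)
  assume "locale_map X terminal_locale f"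
  then have f: "frame_map terminal_locale X f" by (simp add: locale_map_def)
  show "f p = terminal_map X p"
    using frame_map_top[OF f] frame_map_bottom[OF frame_terminal_locale assms f]
    by (cases p) (auto simp: terminal_map_def terminal_locale_simps)
qed

subsection \<open>Subframes, nuclei and sublocales\<close>

lemma partial_order_subset:
  assumes "partial_order L" "S \<subseteq> carrier L"
  shows "partial_order (L\<lparr>carrier := S\<rparr>)"
proof -
  interpret partial_order L by fact
  interpret weak_partial_order "L\<lparr>carrier := S\<rparr>"
    using assms(2) by (intro weak_partial_order_subset weak_partial_order_axioms)
  show ?thesis
    by unfold_locales (simp add: eq_is_equal)
qed

lemma (in frame) subframe:
  assumes S: "S \<subseteq> carrier L" and top: "\<top> \<in> S"
    and meet_all: "\<forall>x\<in>S. \<forall>y\<in>S. x \<sqinter> y \<in> S"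
    and sup_all: "\<forall>A. A \<subseteq> S \<longrightarrow> \<Squnion>A \<in> S"
  shows "frame (L\<lparr>carrier := S\<rparr>)" and "frame_map (L\<lparr>carrier := S\<rparr>) L (\<lambda>x. x)"
    and "frame_map K L f \<Longrightarrow> f ` carrier K \<subseteq> S \<Longrightarrow> frame_map K (L\<lparr>carrier := S\<rparr>) f"
proof -
  let ?L = "L\<lparr>carrier := S\<rparr>"
  have meet: "x \<sqinter> y \<in> S" if "x \<in> S" "y \<in> S" for x y using that meet_all by blast
  have sup: "\<Squnion>A \<in> S" if "A \<subseteq> S" for A using that sup_all by blast
  have in_carrier: "x \<in> carrier L" if "x \<in> S" for x using that S by blast
  have sub_carrier: "A \<subseteq> carrier L" if "A \<subseteq> S" for A using that S by blast
  have po: "partial_order ?L"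
    by (rule partial_order_subset[OF partial_order_axioms S])
  have meet_im: "(\<sqinter>) x ` A \<subseteq> carrier L" if "x \<in> S" "A \<subseteq> S" for x A
    using that in_carrier by (auto intro!: meet_closed)
  have fr: "frame ?L"
    and sup': "\<And>A. A \<subseteq> carrier ?L \<Longrightarrow> \<Squnion>\<^bsub>?L\<^esub>A = \<Squnion>A"
    and meet': "\<And>x y. x \<in> carrier ?L \<Longrightarrow> y \<in> carrier ?L \<Longrightarrow> x \<sqinter>\<^bsub>?L\<^esub> y = x \<sqinter> y"
    by (rule frameI[OF po, where S = "\<lambda>A. \<Squnion>A" and M = "(\<sqinter>)"];
        auto simp: sup meet in_carrier sub_carrier meet_left meet_right meet_sup_distrib
          intro!: sup_upper sup_least meet_le le_refl sup_closed meet_im)+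
  show "frame ?L" by (rule fr)
  have top': "\<top>\<^bsub>?L\<^esub> = \<top>"
    using top S by (intro top_eqI fr) (auto simp: top_higher)
  show "frame_map ?L L (\<lambda>x. x)"
    unfolding frame_map_def using S sup' meet' top' by (auto simp: image_def)
  show "frame_map K ?L f" if f: "frame_map K L f" and r: "f ` carrier K \<subseteq> S"
  proof -
    have mem: "f x \<in> S" if "x \<in> carrier K" for x using r that by blast
    have "\<Squnion>\<^bsub>?L\<^esub>(f ` A) = \<Squnion>(f ` A)" if "A \<subseteq> carrier K" for A
      using mem that by (intro sup') auto
    then show ?thesis
      using f mem meet' top' unfolding frame_map_def by auto
  qed
qed

lemma (in frame) nucleus:
  assumes S: "S \<subseteq> carrier L"
    and j_closure: "\<forall>x\<in>carrier L. j x \<in> S \<and> x \<sqsubseteq> j x \<and> (\<forall>s\<in>S. x \<sqsubseteq> s \<longrightarrow> j x \<sqsubseteq> s)"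
    and j_meet_all: "\<forall>x\<in>carrier L. \<forall>y\<in>carrier L. j x \<sqinter> j y \<sqsubseteq> j (x \<sqinter> y)"
  shows "is_sublocale L (L\<lparr>carrier := S\<rparr>, j)"
    and "s \<in> S \<Longrightarrow> j s = s"
    and "frame M \<Longrightarrow> frame_map L M h \<Longrightarrow> \<forall>x\<in>carrier L. h (j x) = h x \<Longrightarrow>
          frame_map (L\<lparr>carrier := S\<rparr>) M h"
proof -
  let ?L = "L\<lparr>carrier := S\<rparr>"
  have j_mem: "j x \<in> S" and j_ge: "x \<sqsubseteq> j x" if "x \<in> carrier L" for x
    using that j_closure by blast+
  have j_least: "j x \<sqsubseteq> s" if "x \<in> carrier L" "s \<in> S" "x \<sqsubseteq> s" for x s
    using that j_closure by blast
  have j_meet: "j x \<sqinter> j y \<sqsubseteq> j (x \<sqinter> y)" if "x \<in> carrier L" "y \<in> carrier L" for x y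
    using that j_meet_all by blast
  have in_carrier: "x \<in> carrier L" if "x \<in> S" for x using that S by blast
  have sub_carrier: "A \<subseteq> carrier L" if "A \<subseteq> S" for A using that S by blast
  have po: "partial_order ?L"
    by (rule partial_order_subset[OF partial_order_axioms S])
  have j_closed: "j x \<in> carrier L" if "x \<in> carrier L" for x
    using that j_mem S by blast
  have j_fix: "j s = s" if "s \<in> S" for s
    using that by (intro le_antisym j_least j_ge) (auto simp: in_carrier j_closed)
  then show "s \<in> S \<Longrightarrow> j s = s" .
  have j_mono: "j x \<sqsubseteq> j y" if "x \<in> carrier L" "y \<in> carrier L" "x \<sqsubseteq> y" for x y
    using that by (meson j_closed j_ge j_least j_mem le_trans)
  have j_meet_eq: "j (x \<sqinter> y) = j x \<sqinter> j y" if x: "x \<in> carrier L" and y: "y \<in> carrier L" for x y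
    using x y by (intro le_antisym meet_le j_mono j_meet) (auto simp: j_closed meet_left meet_right)
  have meet_S: "x \<sqinter> y \<in> S" if "x \<in> S" "y \<in> S" for x y
    using that by (metis j_fix j_meet_eq j_mem in_carrier meet_closed)
  have meet_im: "(\<sqinter>) x ` A \<subseteq> carrier L" if "x \<in> S" "A \<subseteq> S" for x A
    using that in_carrier by (auto intro!: meet_closed)
  have up: "x \<sqsubseteq> j (\<Squnion>A)" if "A \<subseteq> S" "x \<in> A" for x A
    using that by (meson j_closed j_ge in_carrier sub_carrier le_trans sup_closed sup_upper subsetD)
  have dist: "x \<sqinter> j (\<Squnion>A) \<sqsubseteq> j (\<Squnion>((\<sqinter>) x ` A))" if "x \<in> S" "A \<subseteq> S" for x A
    using that by (metis j_fix j_meet in_carrier sub_carrier meet_sup_distrib sup_closed)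
  have fr: "frame ?L"
    and sup': "\<And>A. A \<subseteq> carrier ?L \<Longrightarrow> \<Squnion>\<^bsub>?L\<^esub>A = j (\<Squnion>A)"
    and meet': "\<And>x y. x \<in> carrier ?L \<Longrightarrow> y \<in> carrier ?L \<Longrightarrow> x \<sqinter>\<^bsub>?L\<^esub> y = x \<sqinter> y"
    by (rule frameI[OF po, where S = "\<lambda>A. j (\<Squnion>A)" and M = "(\<sqinter>)"];
        auto simp: j_mem meet_S in_carrier sub_carrier meet_left meet_right dist
          intro!: up j_least sup_least meet_le sup_closed)+
  have top': "\<top>\<^bsub>?L\<^esub> = j \<top>"
  proof (rule top_eqI[OF fr])
    fix x assume "x \<in> carrier ?L"
    then have "x \<sqsubseteq> \<top>" "x \<in> carrier L" using in_carrier by (auto intro: top_higher)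
    then show "x \<sqsubseteq>\<^bsub>?L\<^esub> j \<top>"
      using le_trans[OF _ j_ge[OF top_closed]] j_closed by simp
  qed (simp add: j_mem)
  have j_sup: "j (\<Squnion>(j ` A)) = j (\<Squnion>A)" if A: "A \<subseteq> carrier L" for A
  proof (rule le_antisym)
    have jA: "j ` A \<subseteq> carrier L" using A j_closed by auto
    show "j (\<Squnion>(j ` A)) \<sqsubseteq> j (\<Squnion>A)"
      using A jA by (intro j_least sup_least j_mem) (auto simp: j_closed intro!: j_mono sup_upper)
    show "j (\<Squnion>A) \<sqsubseteq> j (\<Squnion>(j ` A))"
    proof (intro j_mono sup_least A)
      fix x assume x: "x \<in> A"
      then have "x \<sqsubseteq> j x" "j x \<sqsubseteq> \<Squnion>(j ` A)" using A jA by (auto intro!: j_ge sup_upper)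
      then show "x \<sqsubseteq> \<Squnion>(j ` A)" using x A jA by (meson image_subset_iff le_trans subsetD sup_closed)
    qed (use A jA in auto)
  qed (use A j_closed in \<open>auto intro!: j_closed sup_closed\<close>)
  have "frame_map L ?L j"
    unfolding frame_map_def
  proof (intro conjI ballI allI impI)
    fix A assume A: "A \<subseteq> carrier L"
    then have "j ` A \<subseteq> carrier ?L" using j_mem by auto
    then show "j (\<Squnion>A) = \<Squnion>\<^bsub>?L\<^esub>(j ` A)"
      using A by (simp only: sup' j_sup)
  qed (auto simp: j_mem top' meet' j_meet_eq)
  moreover have "j ` carrier L = S"
    using j_mem j_fix in_carrier by (auto simp: image_iff) metis
  ultimately show "is_sublocale L (?L, j)"
    by (simp add: is_sublocale_def locale_map_def fr)
  show "frame_map ?L M h"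
    if M: "frame M" and h: "frame_map L M h" and hj: "\<forall>x\<in>carrier L. h (j x) = h x"
  proof -
    have "h (\<Squnion>\<^bsub>?L\<^esub>A) = \<Squnion>\<^bsub>M\<^esub>(h ` A)" if "A \<subseteq> S" for A
      using that sub_carrier[of A] by (simp add: sup' hj frame_map_sup[OF h])
    moreover have "h (x \<sqinter>\<^bsub>?L\<^esub> y) = h x \<sqinter>\<^bsub>M\<^esub> h y" if "x \<in> S" "y \<in> S" for x y
      using that by (simp add: meet' frame_map_meet[OF h] in_carrier)
    ultimately show ?thesis
      using frame_map_top[OF h] frame_map_closed[OF h] S
      unfolding frame_map_def top' by (auto simp: hj in_carrier)
  qed
qed

lemma sublocale_inclusion_mono:
  assumes "is_sublocale X B" "\<forall>U\<in>carrier X. i (snd B U) = i' (snd B U)" "V \<in> carrier (fst B)"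
  shows "i V = i' V"
  using assms unfolding is_sublocale_def by (metis imageE)

lemma sub_eq_iff:
  assumes A: "is_sublocale X A" and B: "is_sublocale X B"
  shows "sub_eq X A B \<longleftrightarrow> sub_le X A B \<and> sub_le X B A"
proof
  assume "sub_eq X A B"
  then obtain i g where i: "sub_inclusion X A B i" and g: "locale_map (fst B) (fst A) g"
    and gi: "\<forall>V\<in>carrier (fst B). g (i V) = V"
    unfolding sub_eq_def locale_iso_def by metis
  have "snd B U \<in> carrier (fst B)" if "U \<in> carrier X" for U
    using B that unfolding is_sublocale_def locale_map_def by (metis frame_map_closed)
  then have "sub_inclusion X B A g"
    using i g gi unfolding sub_inclusion_def by metis
  then show "sub_le X A B \<and> sub_le X B A" using i unfolding sub_le_def by metis
next
  assume "sub_le X A B \<and> sub_le X B A"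
  then obtain i g where i: "sub_inclusion X A B i" and g: "sub_inclusion X B A g"
    unfolding sub_le_def by metis
  have "\<forall>V\<in>carrier (fst B). g (i V) = V" "\<forall>U\<in>carrier (fst A). i (g U) = U"
    using sublocale_inclusion_mono[OF B, of "\<lambda>V. g (i V)" "\<lambda>V. V"]
      sublocale_inclusion_mono[OF A, of "\<lambda>U. i (g U)" "\<lambda>U. U"] i g
    unfolding sub_inclusion_def by simp_all
  then have "locale_iso (fst A) (fst B) i"
    using i g unfolding locale_iso_def sub_inclusion_def by metis
  then show "sub_eq X A B" using i unfolding sub_eq_def by metis
qed

lemma direct_image_adjoint:
  assumes X: "frame X" and Y: "frame Y" and f: "locale_map X Y f"
    and U: "U \<in> carrier X" and V: "V \<in> carrier Y"
  shows "V \<sqsubseteq>\<^bsub>Y\<^esub> direct_image X Y f U \<longleftrightarrow> f V \<sqsubseteq>\<^bsub>X\<^esub> U"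
    and "direct_image X Y f U \<in> carrier Y"
proof -
  interpret X: frame X by fact
  interpret Y: frame Y by fact
  have f: "frame_map Y X f" using f by (simp add: locale_map_def)
  let ?A = "{V \<in> carrier Y. f V \<sqsubseteq>\<^bsub>X\<^esub> U}"
  have A: "?A \<subseteq> carrier Y" by blast
  show c: "direct_image X Y f U \<in> carrier Y"
    unfolding direct_image_def by (rule Y.sup_closed[OF A])
  have fA: "f ` ?A \<subseteq> carrier X" using frame_map_closed[OF f] by auto
  have le: "f (direct_image X Y f U) \<sqsubseteq>\<^bsub>X\<^esub> U"
    unfolding direct_image_def frame_map_sup[OF f A] using U fA by (auto intro!: X.sup_least)
  show "V \<sqsubseteq>\<^bsub>Y\<^esub> direct_image X Y f U \<longleftrightarrow> f V \<sqsubseteq>\<^bsub>X\<^esub> U"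
  proof
    assume "V \<sqsubseteq>\<^bsub>Y\<^esub> direct_image X Y f U"
    then have "f V \<sqsubseteq>\<^bsub>X\<^esub> f (direct_image X Y f U)"
      using frame_map_mono[OF Y X f V c] by blast
    then show "f V \<sqsubseteq>\<^bsub>X\<^esub> U"
      using le U V c frame_map_closed[OF f] by (meson X.le_trans)
  next
    assume "f V \<sqsubseteq>\<^bsub>X\<^esub> U"
    then show "V \<sqsubseteq>\<^bsub>Y\<^esub> direct_image X Y f U"
      unfolding direct_image_def using A V by (intro Y.sup_upper) auto
  qed
qed

lemma image_sub:
  assumes X: "frame X" and A: "frame A" and f: "locale_map A X f"
  shows "is_sublocale X (image_sub X A f)"
    and "locale_map A (fst (image_sub X A f)) (\<lambda>a. a)"
    and "is_sublocale X B \<Longrightarrow> locale_map A (fst B) h \<Longrightarrow> (\<And>U. U \<in> carrier X \<Longrightarrow> h (snd B U) = f U) \<Longrightarrow>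
          sub_le X (image_sub X A f) B"
proof -
  interpret X: frame X by fact
  interpret A: frame A by fact
  have f: "frame_map X A f" using f by (simp add: locale_map_def)
  have S: "f ` carrier X \<subseteq> carrier A" using frame_map_closed[OF f] by blast
  have top: "\<top>\<^bsub>A\<^esub> \<in> f ` carrier X" using frame_map_top[OF f] by (metis X.top_closed image_eqI)
  have meet: "x \<sqinter>\<^bsub>A\<^esub> y \<in> f ` carrier X" if "x \<in> f ` carrier X" "y \<in> f ` carrier X" for x y
  proof -
    from that(1) obtain a where a: "x = f a" "a \<in> carrier X" by (rule imageE)
    from that(2) obtain b where b: "y = f b" "b \<in> carrier X" by (rule imageE)
    have "x \<sqinter>\<^bsub>A\<^esub> y = f (a \<sqinter>\<^bsub>X\<^esub> b)" unfolding a(1) b(1) by (rule frame_map_meet[OF f a(2) b(2), symmetric])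
    then show ?thesis using X.meet_closed[OF a(2) b(2)] by (rule image_eqI)
  qed
  have sup: "\<Squnion>\<^bsub>A\<^esub>K \<in> f ` carrier X" if "K \<subseteq> f ` carrier X" for K
  proof -
    from that obtain K' where K': "K' \<subseteq> carrier X" "K = f ` K'" by (rule subset_imageE)
    then have "\<Squnion>\<^bsub>A\<^esub>K = f (\<Squnion>\<^bsub>X\<^esub>K')" by (simp add: frame_map_sup[OF f])
    then show ?thesis using X.sup_closed[OF K'(1)] by (rule image_eqI)
  qed
  have "\<forall>x\<in>f ` carrier X. \<forall>y\<in>f ` carrier X. x \<sqinter>\<^bsub>A\<^esub> y \<in> f ` carrier X"
    and "\<forall>K. K \<subseteq> f ` carrier X \<longrightarrow> \<Squnion>\<^bsub>A\<^esub>K \<in> f ` carrier X"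
    using meet sup by blast+
  note sf = A.subframe[OF S top this]
  show "is_sublocale X (image_sub X A f)"
    unfolding is_sublocale_def locale_map_def image_sub_def fst_conv snd_conv
    using sf(1) sf(3)[OF f order_refl] by simp
  show "locale_map A (fst (image_sub X A f)) (\<lambda>a. a)"
    unfolding locale_map_def image_sub_def fst_conv by (rule sf(2))
  assume B: "is_sublocale X B" and h: "locale_map A (fst B) h"
    and hB: "\<And>U. U \<in> carrier X \<Longrightarrow> h (snd B U) = f U"
  have h: "frame_map (fst B) A h" using h by (simp add: locale_map_def)
  have "h ` carrier (fst B) \<subseteq> f ` carrier X"
  proof
    fix z assume "z \<in> h ` carrier (fst B)"
    then obtain U where U: "U \<in> carrier X" "z = h (snd B U)"
      using B unfolding is_sublocale_def by (metis imageE)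
    then show "z \<in> f ` carrier X" using hB by blast
  qed
  from sf(3)[OF h this] have "sub_inclusion X (image_sub X A f) B h"
    unfolding sub_inclusion_def locale_map_def image_sub_def fst_conv snd_conv using hB by blast
  then show "sub_le X (image_sub X A f) B" unfolding sub_le_def by blast
qed

lemma weakly_closed_any_type:
  fixes X :: "'x gorder" and A :: "('x, 'a) subloc" and B :: "('x, 'b) subloc"
  assumes X: "frame X" and A: "is_sublocale X A" and wc: "weakly_closed X A"
    and B: "is_sublocale X B" and i: "sub_inclusion X A B i"
    and dense: "strongly_dense (fst A) (fst B) i"
  shows "locale_iso (fst A) (fst B) i"
proof -
  interpret X: frame X by fact
  interpret F: frame "fst A" using A by (simp add: is_sublocale_def)
  interpret G: frame "fst B" using B by (simp add: is_sublocale_def)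
  define b where "b = snd B"
  define r where "r = direct_image (fst B) X b"
  define S where "S = r ` carrier (fst B)"
  define j where "j = r \<circ> b"
  have bmap: "locale_map (fst B) X b" using B by (simp add: is_sublocale_def b_def)
  then have bf: "frame_map X (fst B) b" by (simp add: locale_map_def)
  have bc: "b x \<in> carrier (fst B)" if "x \<in> carrier X" for x
    using that by (rule frame_map_closed[OF bf])
  have bim: "b ` carrier X = carrier (fst B)" using B by (simp add: is_sublocale_def b_def)
  note adj = direct_image_adjoint(1)[OF G.frame_axioms X bmap, folded r_def]
  note rc = direct_image_adjoint(2)[OF G.frame_axioms X bmap _ X.top_closed, folded r_def]
  have br: "b (r y) = y" if y: "y \<in> carrier (fst B)" for y
  proof (rule G.le_antisym)
    show "b (r y) \<sqsubseteq>\<^bsub>fst B\<^esub> y" using adj[OF y rc[OF y]] X.le_refl[OF rc[OF y]] by blast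
    have "y \<in> b ` carrier X" unfolding bim by (rule y)
    then obtain x where x: "y = b x" "x \<in> carrier X" by (rule imageE)
    then have "x \<sqsubseteq>\<^bsub>X\<^esub> r y" using adj[OF y x(2)] G.le_refl[OF y] by simp
    then show "y \<sqsubseteq>\<^bsub>fst B\<^esub> b (r y)"
      using frame_map_mono[OF X G.frame_axioms bf x(2) rc[OF y]] x by simp
  qed (use y rc bc in auto)
  have S: "S \<subseteq> carrier X" unfolding S_def using rc by auto
  have j_mem: "j x \<in> S" if "x \<in> carrier X" for x
    unfolding S_def j_def using bc[OF that] by auto
  have j_ge: "x \<sqsubseteq>\<^bsub>X\<^esub> j x" if "x \<in> carrier X" for x
    unfolding j_def using adj[OF bc[OF that] that] G.le_refl[OF bc[OF that]] by simp
  have r_mono: "r y \<sqsubseteq>\<^bsub>X\<^esub> r z" if "y \<in> carrier (fst B)" "z \<in> carrier (fst B)" "y \<sqsubseteq>\<^bsub>fst B\<^esub> z" for y z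
    using adj[OF that(2) rc[OF that(1)]] br[OF that(1)] that by simp
  have j_least: "j x \<sqsubseteq>\<^bsub>X\<^esub> s" if "x \<in> carrier X" "s \<in> S" "x \<sqsubseteq>\<^bsub>X\<^esub> s" for x s
  proof -
    obtain y where y: "y \<in> carrier (fst B)" "s = r y" using \<open>s \<in> S\<close> unfolding S_def by blast
    then show ?thesis using that adj[OF y(1) that(1)] r_mono[OF bc[OF that(1)] y(1)] by (simp add: j_def)
  qed
  have j_meet: "j x \<sqinter>\<^bsub>X\<^esub> j y \<sqsubseteq>\<^bsub>X\<^esub> j (x \<sqinter>\<^bsub>X\<^esub> y)" if x: "x \<in> carrier X" and y: "y \<in> carrier X" for x y
  proof -
    have "b (j x \<sqinter>\<^bsub>X\<^esub> j y) = b x \<sqinter>\<^bsub>fst B\<^esub> b y"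
      using x y bc rc br by (simp add: frame_map_meet[OF bf] j_def)
    also have "\<dots> = b (x \<sqinter>\<^bsub>X\<^esub> y)" using x y by (simp add: frame_map_meet[OF bf])
    finally show ?thesis
      using x y bc rc adj[of "b (x \<sqinter>\<^bsub>X\<^esub> y)" "j x \<sqinter>\<^bsub>X\<^esub> j y"] by (simp add: j_def)
  qed
  have "\<forall>x\<in>carrier X. j x \<in> S \<and> x \<sqsubseteq>\<^bsub>X\<^esub> j x \<and> (\<forall>s\<in>S. x \<sqsubseteq>\<^bsub>X\<^esub> s \<longrightarrow> j x \<sqsubseteq>\<^bsub>X\<^esub> s)"
    and "\<forall>x\<in>carrier X. \<forall>y\<in>carrier X. j x \<sqinter>\<^bsub>X\<^esub> j y \<sqsubseteq>\<^bsub>X\<^esub> j (x \<sqinter>\<^bsub>X\<^esub> y)"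
    using j_mem j_ge j_least j_meet by blast+
  note nuc = X.nucleus[OF S this]
  let ?B = "(X\<lparr>carrier := S\<rparr>, j)"
  have bj: "\<forall>x\<in>carrier X. b (j x) = b x"
    using br bc by (simp add: j_def)
  have bS: "frame_map (fst ?B) (fst B) b"
    using nuc(3)[OF G.frame_axioms bf bj] by simp
  have ifm: "frame_map (fst B) (fst A) i" using i by (simp add: sub_inclusion_def locale_map_def)
  have incl: "sub_inclusion X A ?B (i \<circ> b)"
    using i frame_map_comp[OF bS ifm] bj by (auto simp: sub_inclusion_def locale_map_def b_def)
  interpret S: frame "fst ?B" using nuc(1) by (simp only: is_sublocale_def)
  have r_fm: "frame_map (fst B) (fst ?B) r"
  proof -
    have rS: "r y \<in> S" if "y \<in> carrier (fst B)" for y using that S_def by blast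
    have jx: "frame_map X (fst ?B) j" using nuc(1) by (simp add: is_sublocale_def locale_map_def)
    have rj: "r (b x) = j x" for x by (simp add: j_def)
    have "r (y \<sqinter>\<^bsub>fst B\<^esub> z) = r y \<sqinter>\<^bsub>fst ?B\<^esub> r z" if "y \<in> carrier (fst B)" "z \<in> carrier (fst B)" for y z
    proof -
      obtain x x' where x: "x \<in> carrier X" "x' \<in> carrier X" "y = b x" "z = b x'"
        using \<open>y \<in> _\<close> \<open>z \<in> _\<close> bim by blast
      have "b x \<sqinter>\<^bsub>fst B\<^esub> b x' = b (x \<sqinter>\<^bsub>X\<^esub> x')" using x frame_map_meet[OF bf] by simp
      then show ?thesis unfolding x rj using frame_map_meet[OF jx] x rj by metis
    qed
    moreover have "r \<top>\<^bsub>fst B\<^esub> = \<top>\<^bsub>fst ?B\<^esub>"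
      using frame_map_top[OF bf] frame_map_top[OF jx] rj by metis
    moreover have "r (\<Squnion>\<^bsub>fst B\<^esub>K) = \<Squnion>\<^bsub>fst ?B\<^esub>(r ` K)" if "K \<subseteq> carrier (fst B)" for K
    proof -
      obtain K' where K': "K' \<subseteq> carrier X" "K = b ` K'" using \<open>K \<subseteq> _\<close> bim by (metis subset_image_iff)
      have "\<Squnion>\<^bsub>fst B\<^esub>K = b (\<Squnion>\<^bsub>X\<^esub>K')" using K' frame_map_sup[OF bf] by simp
      then have "r (\<Squnion>\<^bsub>fst B\<^esub>K) = \<Squnion>\<^bsub>fst ?B\<^esub>(j ` K')" using frame_map_sup[OF jx K'(1)] rj by metis
      moreover have "j ` K' = r ` K" unfolding K'(2) j_def by (simp add: image_comp)
      ultimately show ?thesis by simp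
    qed
    ultimately show ?thesis using rS unfolding frame_map_def by auto
  qed
  have "strongly_dense (fst A) (fst ?B) (i \<circ> b)"
    unfolding strongly_dense_def
  proof
    fix p :: bool
    assume "p \<in> carrier terminal_locale"
    have tA: "frame_map terminal_locale (fst A) (terminal_map (fst A))"
      and tB: "frame_map terminal_locale (fst B) (terminal_map (fst B))"
      using terminal_map(1)[OF F.frame_axioms] terminal_map(1)[OF G.frame_axioms] by (auto simp: locale_map_def)
    have pA: "terminal_map (fst A) p \<in> carrier (fst A)"
      and pB: "terminal_map (fst B) p \<in> carrier (fst B)"
      and pS: "terminal_map (fst ?B) p \<in> carrier (fst ?B)"
      unfolding terminal_map_def by (auto simp del: fst_conv)
    have tS: "r (terminal_map (fst B) p) = terminal_map (fst ?B) p"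
      using terminal_map(2)[OF S.frame_axioms, of "r \<circ> terminal_map (fst B)"] frame_map_comp[OF tB r_fm]
      by (auto simp: locale_map_def)
    let ?d = "direct_image (fst A) (fst ?B) (i \<circ> b) (terminal_map (fst A) p)"
    have lm: "locale_map (fst A) (fst ?B) (i \<circ> b)" using incl by (simp add: sub_inclusion_def)
    have li: "locale_map (fst A) (fst B) i" using i by (simp add: sub_inclusion_def)
    have dc: "?d \<in> carrier (fst ?B)"
      using direct_image_adjoint(2)[OF F.frame_axioms S.frame_axioms lm pA S.top_closed] .
    have "(i \<circ> b) ?d \<sqsubseteq>\<^bsub>fst A\<^esub> terminal_map (fst A) p"
      using direct_image_adjoint(1)[OF F.frame_axioms S.frame_axioms lm pA dc] S.le_refl[OF dc] by blast
    then have ib: "i (b ?d) \<sqsubseteq>\<^bsub>fst A\<^esub> terminal_map (fst A) p" by simp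
    have dX: "?d \<in> carrier X" using dc S by auto
    have "b ?d \<sqsubseteq>\<^bsub>fst B\<^esub> direct_image (fst A) (fst B) i (terminal_map (fst A) p)"
      using direct_image_adjoint(1)[OF F.frame_axioms G.frame_axioms li pA bc[OF dX]] ib by blast
    moreover have "direct_image (fst A) (fst B) i (terminal_map (fst A) p) \<sqsubseteq>\<^bsub>fst B\<^esub> terminal_map (fst B) p"
      using dense \<open>p \<in> _\<close> unfolding strongly_dense_def by blast
    ultimately have "b ?d \<sqsubseteq>\<^bsub>fst B\<^esub> terminal_map (fst B) p"
      using bc[OF dX] pB direct_image_adjoint(2)[OF F.frame_axioms G.frame_axioms li pA G.top_closed]
      by (meson G.le_trans)
    then have "?d \<sqsubseteq>\<^bsub>X\<^esub> r (terminal_map (fst B) p)" using adj[OF pB dX] by blast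
    then show "?d \<sqsubseteq>\<^bsub>fst ?B\<^esub> terminal_map (fst ?B) p" unfolding tS by simp
  qed
  then have "locale_iso (fst A) (fst ?B) (i \<circ> b)"
    using wc nuc(1) incl unfolding weakly_closed_def by blast
  then obtain g where g: "frame_map (fst A) (fst ?B) g"
      "\<forall>V\<in>S. g (i (b V)) = V" "\<forall>U\<in>carrier (fst A). i (b (g U)) = U"
    unfolding locale_iso_def locale_map_def by auto
  have "frame_map (fst A) (fst B) (b \<circ> g)" by (rule frame_map_comp[OF g(1) bS])
  moreover have "b (g (i V)) = V" if "V \<in> carrier (fst B)" for V
  proof -
    have "r V \<in> S" using that S_def by blast
    then show ?thesis using g(2) br[OF that] by metis
  qed
  ultimately show ?thesis
    using g(3) ifm unfolding locale_iso_def locale_map_def by (auto intro!: exI[of _ "b \<circ> g"])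
qed

subsection \<open>Coequalisers and equalisers\<close>

lemma coequaliser:
  fixes X :: "'x gorder" and R :: "'r gorder"
  assumes X: "frame X" and R: "frame R" and s: "locale_map R X s" and t: "locale_map R X t"
  defines "Q \<equiv> coequaliser X s t"
  shows "frame (fst Q)"
    and "locale_map X (fst Q) (snd Q)"
    and "\<forall>V\<in>carrier (fst Q). s (snd Q V) = t (snd Q V)"
    and "locale_map X W h \<Longrightarrow> \<forall>V\<in>carrier W. s (h V) = t (h V) \<Longrightarrow>
          \<exists>k. locale_map (fst Q) W k \<and> (\<forall>V\<in>carrier W. snd Q (k V) = h V)"
    and "\<forall>V\<in>carrier W. snd Q (k V) = snd Q (k' V) \<Longrightarrow> V \<in> carrier W \<Longrightarrow> k V = k' V"
proof -
  interpret X: frame X by fact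
  have s: "frame_map X R s" and t: "frame_map X R t" using s t by (simp_all add: locale_map_def)
  let ?S = "{U \<in> carrier X. s U = t U}"
  have S: "?S \<subseteq> carrier X" by blast
  have top: "\<top>\<^bsub>X\<^esub> \<in> ?S" using frame_map_top[OF s] frame_map_top[OF t] by simp
  have meet: "\<forall>x\<in>?S. \<forall>y\<in>?S. x \<sqinter>\<^bsub>X\<^esub> y \<in> ?S"
    using frame_map_meet[OF s] frame_map_meet[OF t] by simp
  have sup: "\<forall>A. A \<subseteq> ?S \<longrightarrow> \<Squnion>\<^bsub>X\<^esub>A \<in> ?S"
  proof (intro allI impI)
    fix A assume A: "A \<subseteq> ?S"
    then have AX: "A \<subseteq> carrier X" by blast
    have im: "s ` A = t ` A" using A by (intro image_cong) auto
    show "\<Squnion>\<^bsub>X\<^esub>A \<in> ?S"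
      using X.sup_closed[OF AX] frame_map_sup[OF s AX] frame_map_sup[OF t AX] im by simp
  qed
  note sf = X.subframe[OF S top meet sup]
  show "frame (fst Q)" using sf(1) by (simp add: Q_def coequaliser_def)
  show "locale_map X (fst Q) (snd Q)" using sf(2) by (simp add: Q_def coequaliser_def locale_map_def)
  show "\<forall>V\<in>carrier (fst Q). s (snd Q V) = t (snd Q V)" by (simp add: Q_def coequaliser_def)
  show "\<exists>k. locale_map (fst Q) W k \<and> (\<forall>V\<in>carrier W. snd Q (k V) = h V)"
    if h: "locale_map X W h" and eq: "\<forall>V\<in>carrier W. s (h V) = t (h V)"
  proof -
    have h: "frame_map W X h" using h by (simp add: locale_map_def)
    have "h ` carrier W \<subseteq> ?S" using eq frame_map_closed[OF h] by blast
    then show ?thesis using sf(3)[OF h] by (auto simp: Q_def coequaliser_def locale_map_def)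
  qed
  show "k V = k' V" if "\<forall>V\<in>carrier W. snd Q (k V) = snd Q (k' V)" "V \<in> carrier W" for k k' V
    using that by (simp add: Q_def coequaliser_def)
qed

lemma equaliser:
  fixes Z :: "'z gorder" and Y :: "'y gorder" and W :: "'w gorder"
  assumes Z: "frame Z" and f: "locale_map Z Y f" and g: "locale_map Z Y g"
  defines "E \<equiv> equaliser Z Y f g"
  shows "is_sublocale Z E"
    and "\<forall>V\<in>carrier Y. snd E (f V) = snd E (g V)"
    and "frame W \<Longrightarrow> locale_map W Z h \<Longrightarrow> \<forall>V\<in>carrier Y. h (f V) = h (g V) \<Longrightarrow>
          \<exists>k. locale_map W (fst E) k \<and> (\<forall>U\<in>carrier Z. k (snd E U) = h U)"
proof -
  interpret Z: frame Z by fact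
  have fc: "f V \<in> carrier Z" and gc: "g V \<in> carrier Z" if "V \<in> carrier Y" for V
    using that f g frame_map_closed by (auto simp: locale_map_def)
  define S where "S = equaliser_opens Z Y f g"
  define j where "j = (\<lambda>z. \<Sqinter>\<^bsub>Z\<^esub>{s \<in> S. z \<sqsubseteq>\<^bsub>Z\<^esub> s})"
  have E: "E = (Z\<lparr>carrier := S\<rparr>, j)" by (simp add: E_def equaliser_def S_def j_def)
  have S_iff: "z \<in> S \<longleftrightarrow> z \<in> carrier Z \<and> (\<forall>V\<in>carrier Y. \<forall>w\<in>carrier Z.
     w \<sqinter>\<^bsub>Z\<^esub> f V \<sqsubseteq>\<^bsub>Z\<^esub> z \<longleftrightarrow> w \<sqinter>\<^bsub>Z\<^esub> g V \<sqsubseteq>\<^bsub>Z\<^esub> z)" for z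
    by (simp add: S_def equaliser_opens_def)
  have S: "S \<subseteq> carrier Z" using S_iff by blast
  have le_Inf: "w \<sqsubseteq>\<^bsub>Z\<^esub> \<Sqinter>\<^bsub>Z\<^esub>A \<longleftrightarrow> (\<forall>a\<in>A. w \<sqsubseteq>\<^bsub>Z\<^esub> a)" if w: "w \<in> carrier Z" and A: "A \<subseteq> carrier Z" for w A
  proof
    assume l: "w \<sqsubseteq>\<^bsub>Z\<^esub> \<Sqinter>\<^bsub>Z\<^esub>A"
    show "\<forall>a\<in>A. w \<sqsubseteq>\<^bsub>Z\<^esub> a"
    proof
      fix a assume a: "a \<in> A"
      show "w \<sqsubseteq>\<^bsub>Z\<^esub> a"
        using Z.le_trans[OF l Z.inf_lower[OF A a]] w A a by (simp add: subset_iff)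
    qed
  next
    assume "\<forall>a\<in>A. w \<sqsubseteq>\<^bsub>Z\<^esub> a"
    then show "w \<sqsubseteq>\<^bsub>Z\<^esub> \<Sqinter>\<^bsub>Z\<^esub>A" by (intro Z.inf_greatest[OF A w]) blast
  qed
  have Inf_S: "\<Sqinter>\<^bsub>Z\<^esub>A \<in> S" if A: "A \<subseteq> S" for A
  proof -
    have AZ: "A \<subseteq> carrier Z" using A S by blast
    show ?thesis
      unfolding S_iff
    proof (intro conjI ballI Z.inf_closed[OF AZ])
      fix V w assume V: "V \<in> carrier Y" and w: "w \<in> carrier Z"
      have c: "w \<sqinter>\<^bsub>Z\<^esub> f V \<in> carrier Z" "w \<sqinter>\<^bsub>Z\<^esub> g V \<in> carrier Z"
        using fc[OF V] gc[OF V] w by simp_all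
      have "w \<sqinter>\<^bsub>Z\<^esub> f V \<sqsubseteq>\<^bsub>Z\<^esub> a \<longleftrightarrow> w \<sqinter>\<^bsub>Z\<^esub> g V \<sqsubseteq>\<^bsub>Z\<^esub> a" if "a \<in> A" for a
        using that A V w S_iff by blast
      then show "w \<sqinter>\<^bsub>Z\<^esub> f V \<sqsubseteq>\<^bsub>Z\<^esub> \<Sqinter>\<^bsub>Z\<^esub>A \<longleftrightarrow> w \<sqinter>\<^bsub>Z\<^esub> g V \<sqsubseteq>\<^bsub>Z\<^esub> \<Sqinter>\<^bsub>Z\<^esub>A"
        unfolding le_Inf[OF c(1) AZ] le_Inf[OF c(2) AZ] by blast
    qed
  qed
  have above: "{s \<in> S. z \<sqsubseteq>\<^bsub>Z\<^esub> s} \<subseteq> carrier Z" for z using S by blast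
  have j_mem: "j z \<in> S" for z unfolding j_def by (rule Inf_S) blast
  have j_closed: "j z \<in> carrier Z" for z using j_mem S by blast
  have j_ge: "z \<sqsubseteq>\<^bsub>Z\<^esub> j z" if z: "z \<in> carrier Z" for z
    unfolding j_def le_Inf[OF z above] by blast
  have j_least: "j z \<sqsubseteq>\<^bsub>Z\<^esub> s" if "s \<in> S" "z \<sqsubseteq>\<^bsub>Z\<^esub> s" for z s
    unfolding j_def using that by (intro Z.inf_lower[OF above]) blast
  define imp where "imp = (\<lambda>x s. \<Squnion>\<^bsub>Z\<^esub>{w \<in> carrier Z. x \<sqinter>\<^bsub>Z\<^esub> w \<sqsubseteq>\<^bsub>Z\<^esub> s})"
  have imp_closed: "imp x s \<in> carrier Z" for x s unfolding imp_def by (rule Z.sup_closed) blast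
  have imp_iff: "w \<sqsubseteq>\<^bsub>Z\<^esub> imp x s \<longleftrightarrow> x \<sqinter>\<^bsub>Z\<^esub> w \<sqsubseteq>\<^bsub>Z\<^esub> s"
    if x: "x \<in> carrier Z" and s: "s \<in> carrier Z" and w: "w \<in> carrier Z" for x s w
  proof
    have A: "{w \<in> carrier Z. x \<sqinter>\<^bsub>Z\<^esub> w \<sqsubseteq>\<^bsub>Z\<^esub> s} \<subseteq> carrier Z" by blast
    have le: "x \<sqinter>\<^bsub>Z\<^esub> imp x s \<sqsubseteq>\<^bsub>Z\<^esub> s" unfolding imp_def Z.meet_sup_le_iff[OF x A s] by blast
    assume l: "w \<sqsubseteq>\<^bsub>Z\<^esub> imp x s"
    have c: "x \<sqinter>\<^bsub>Z\<^esub> w \<in> carrier Z" "x \<sqinter>\<^bsub>Z\<^esub> imp x s \<in> carrier Z"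
      using x w imp_closed by simp_all
    have "x \<sqinter>\<^bsub>Z\<^esub> w \<sqsubseteq>\<^bsub>Z\<^esub> x \<sqinter>\<^bsub>Z\<^esub> imp x s"
      using Z.le_trans[OF Z.meet_right[OF x w] l] Z.meet_left[OF x w] x w c imp_closed
      by (intro Z.meet_le) simp_all
    then show "x \<sqinter>\<^bsub>Z\<^esub> w \<sqsubseteq>\<^bsub>Z\<^esub> s" using Z.le_trans[OF _ le] c s by simp
  next
    assume "x \<sqinter>\<^bsub>Z\<^esub> w \<sqsubseteq>\<^bsub>Z\<^esub> s"
    then show "w \<sqsubseteq>\<^bsub>Z\<^esub> imp x s" unfolding imp_def using w by (intro Z.sup_upper) blast+
  qed
  have imp_S: "imp x s \<in> S" if x: "x \<in> carrier Z" and s: "s \<in> S" for x s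
    unfolding S_iff
  proof (intro conjI ballI imp_closed)
    fix V w assume V: "V \<in> carrier Y" and w: "w \<in> carrier Z"
    note fV = fc[OF V] and gV = gc[OF V]
    have sc: "s \<in> carrier Z" using s S by blast
    have xw: "x \<sqinter>\<^bsub>Z\<^esub> w \<in> carrier Z" using x w by simp
    have "w \<sqinter>\<^bsub>Z\<^esub> f V \<sqsubseteq>\<^bsub>Z\<^esub> imp x s \<longleftrightarrow> (x \<sqinter>\<^bsub>Z\<^esub> w) \<sqinter>\<^bsub>Z\<^esub> f V \<sqsubseteq>\<^bsub>Z\<^esub> s"
      using imp_iff[OF x sc, of "w \<sqinter>\<^bsub>Z\<^esub> f V"] w fV Z.meet_assoc[OF x w fV] by simp
    also have "\<dots> \<longleftrightarrow> (x \<sqinter>\<^bsub>Z\<^esub> w) \<sqinter>\<^bsub>Z\<^esub> g V \<sqsubseteq>\<^bsub>Z\<^esub> s" using s V xw S_iff by blast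
    also have "\<dots> \<longleftrightarrow> w \<sqinter>\<^bsub>Z\<^esub> g V \<sqsubseteq>\<^bsub>Z\<^esub> imp x s"
      using imp_iff[OF x sc, of "w \<sqinter>\<^bsub>Z\<^esub> g V"] w gV Z.meet_assoc[OF x w gV] by simp
    finally show "w \<sqinter>\<^bsub>Z\<^esub> f V \<sqsubseteq>\<^bsub>Z\<^esub> imp x s \<longleftrightarrow> w \<sqinter>\<^bsub>Z\<^esub> g V \<sqsubseteq>\<^bsub>Z\<^esub> imp x s" .
  qed
  have j_meet: "j x \<sqinter>\<^bsub>Z\<^esub> j y \<sqsubseteq>\<^bsub>Z\<^esub> j (x \<sqinter>\<^bsub>Z\<^esub> y)" if x: "x \<in> carrier Z" and y: "y \<in> carrier Z" for x y
  proof -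
    have xy: "x \<sqinter>\<^bsub>Z\<^esub> y \<in> carrier Z" using x y by simp
    let ?s = "j (x \<sqinter>\<^bsub>Z\<^esub> y)"
    have "y \<sqsubseteq>\<^bsub>Z\<^esub> imp x ?s" unfolding imp_iff[OF x j_closed y] by (rule j_ge[OF xy])
    then have "j y \<sqsubseteq>\<^bsub>Z\<^esub> imp x ?s" by (rule j_least[OF imp_S[OF x j_mem]])
    then have "x \<sqinter>\<^bsub>Z\<^esub> j y \<sqsubseteq>\<^bsub>Z\<^esub> ?s" unfolding imp_iff[OF x j_closed j_closed] .
    then have "j y \<sqinter>\<^bsub>Z\<^esub> x \<sqsubseteq>\<^bsub>Z\<^esub> ?s" by (simp only: meet_comm)
    then have "x \<sqsubseteq>\<^bsub>Z\<^esub> imp (j y) ?s" unfolding imp_iff[OF j_closed j_closed x] .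
    then have "j x \<sqsubseteq>\<^bsub>Z\<^esub> imp (j y) ?s" by (rule j_least[OF imp_S[OF j_closed j_mem]])
    then have "j y \<sqinter>\<^bsub>Z\<^esub> j x \<sqsubseteq>\<^bsub>Z\<^esub> ?s" unfolding imp_iff[OF j_closed j_closed j_closed] .
    then show ?thesis by (simp only: meet_comm)
  qed
  have "\<forall>x\<in>carrier Z. j x \<in> S \<and> x \<sqsubseteq>\<^bsub>Z\<^esub> j x \<and> (\<forall>s\<in>S. x \<sqsubseteq>\<^bsub>Z\<^esub> s \<longrightarrow> j x \<sqsubseteq>\<^bsub>Z\<^esub> s)"
    and "\<forall>x\<in>carrier Z. \<forall>y\<in>carrier Z. j x \<sqinter>\<^bsub>Z\<^esub> j y \<sqsubseteq>\<^bsub>Z\<^esub> j (x \<sqinter>\<^bsub>Z\<^esub> y)"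
    using j_mem j_ge j_least j_meet by blast+
  note nuc = Z.nucleus[OF S this]
  show "is_sublocale Z E" unfolding E by (rule nuc(1))
  show "\<forall>V\<in>carrier Y. snd E (f V) = snd E (g V)"
  proof
    fix V assume V: "V \<in> carrier Y"
    have tm: "\<top>\<^bsub>Z\<^esub> \<sqinter>\<^bsub>Z\<^esub> x = x" if "x \<in> carrier Z" for x
      using Z.top_meet[OF that] by (simp only: Z.eq_is_equal)
    have "f V \<sqsubseteq>\<^bsub>Z\<^esub> s \<longleftrightarrow> g V \<sqsubseteq>\<^bsub>Z\<^esub> s" if "s \<in> S" for s
      using that V S_iff[of s] tm[OF fc[OF V]] tm[OF gc[OF V]] Z.top_closed by metis
    then have "{s \<in> S. f V \<sqsubseteq>\<^bsub>Z\<^esub> s} = {s \<in> S. g V \<sqsubseteq>\<^bsub>Z\<^esub> s}" by blast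
    then show "snd E (f V) = snd E (g V)" unfolding E j_def snd_conv by (rule arg_cong)
  qed
  show "\<exists>k. locale_map W (fst E) k \<and> (\<forall>U\<in>carrier Z. k (snd E U) = h U)"
    if W: "frame W" and h: "locale_map W Z h" and eq: "\<forall>V\<in>carrier Y. h (f V) = h (g V)"
  proof -
    interpret W: frame W by (rule W)
    have hf: "frame_map Z W h" using h by (simp add: locale_map_def)
    note hc = frame_map_closed[OF hf]
    note adj = direct_image_adjoint[OF W Z h]
    have hj: "h (j z) = h z" if z: "z \<in> carrier Z" for z
    proof (rule W.le_antisym)
      show "h z \<sqsubseteq>\<^bsub>W\<^esub> h (j z)" by (rule frame_map_mono[OF Z W hf z j_closed j_ge[OF z]])
      let ?d = "direct_image W Z h (h z)"
      have dc: "?d \<in> carrier Z" by (rule adj(2)[OF hc[OF z] z])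
      have "?d \<in> S"
        unfolding S_iff
      proof (intro conjI ballI dc)
        fix V w assume V: "V \<in> carrier Y" and w: "w \<in> carrier Z"
        have c: "w \<sqinter>\<^bsub>Z\<^esub> f V \<in> carrier Z" "w \<sqinter>\<^bsub>Z\<^esub> g V \<in> carrier Z"
          using fc[OF V] gc[OF V] w by simp_all
        have "h (w \<sqinter>\<^bsub>Z\<^esub> f V) = h (w \<sqinter>\<^bsub>Z\<^esub> g V)"
          using frame_map_meet[OF hf w fc[OF V]] frame_map_meet[OF hf w gc[OF V]] eq V by simp
        then show "w \<sqinter>\<^bsub>Z\<^esub> f V \<sqsubseteq>\<^bsub>Z\<^esub> ?d \<longleftrightarrow> w \<sqinter>\<^bsub>Z\<^esub> g V \<sqsubseteq>\<^bsub>Z\<^esub> ?d"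
          unfolding adj(1)[OF hc[OF z] c(1)] adj(1)[OF hc[OF z] c(2)] by simp
      qed
      moreover have "z \<sqsubseteq>\<^bsub>Z\<^esub> ?d"
        unfolding adj(1)[OF hc[OF z] z] by (rule W.le_refl[OF hc[OF z]])
      ultimately have "j z \<sqsubseteq>\<^bsub>Z\<^esub> ?d" by (rule j_least)
      then show "h (j z) \<sqsubseteq>\<^bsub>W\<^esub> h z" unfolding adj(1)[OF hc[OF z] j_closed] .
    qed (rule hc[OF j_closed], rule hc[OF z])
    then have "frame_map (Z\<lparr>carrier := S\<rparr>) W h" by (intro nuc(3)[OF W hf] ballI)
    then show ?thesis unfolding E locale_map_def fst_conv snd_conv using hj by blast
  qed
qed

subsection \<open>Products\<close>

locale frame_pair = X: frame X + Y: frame Y for X :: "'a gorder" and Y :: "'b gorder"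
begin

lemmas X = X.frame_axioms and Y = Y.frame_axioms

lemma product_openD:
  assumes "product_open X Y D"
  shows product_open_subset: "D \<subseteq> carrier X \<times> carrier Y"
    and "\<forall>a\<in>carrier X. \<forall>b\<in>carrier Y. \<forall>a'\<in>carrier X. \<forall>b'\<in>carrier Y.
        (a, b) \<in> D \<longrightarrow> a' \<sqsubseteq>\<^bsub>X\<^esub> a \<longrightarrow> b' \<sqsubseteq>\<^bsub>Y\<^esub> b \<longrightarrow> (a', b') \<in> D"
    and "A \<subseteq> carrier X \<Longrightarrow> b \<in> carrier Y \<Longrightarrow> A \<times> {b} \<subseteq> D \<Longrightarrow> (\<Squnion>\<^bsub>X\<^esub>A, b) \<in> D"
    and "a \<in> carrier X \<Longrightarrow> B \<subseteq> carrier Y \<Longrightarrow> {a} \<times> B \<subseteq> D \<Longrightarrow> (a, \<Squnion>\<^bsub>Y\<^esub>B) \<in> D"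
proof -
  note D = assms[unfolded product_open_def]
  show "D \<subseteq> carrier X \<times> carrier Y" by (rule D[THEN conjunct1])
  show "\<forall>a\<in>carrier X. \<forall>b\<in>carrier Y. \<forall>a'\<in>carrier X. \<forall>b'\<in>carrier Y.
        (a, b) \<in> D \<longrightarrow> a' \<sqsubseteq>\<^bsub>X\<^esub> a \<longrightarrow> b' \<sqsubseteq>\<^bsub>Y\<^esub> b \<longrightarrow> (a', b') \<in> D"
    by (rule D[THEN conjunct2, THEN conjunct1])
  show "A \<subseteq> carrier X \<Longrightarrow> b \<in> carrier Y \<Longrightarrow> A \<times> {b} \<subseteq> D \<Longrightarrow> (\<Squnion>\<^bsub>X\<^esub>A, b) \<in> D"
    by (rule D[THEN conjunct2, THEN conjunct2, THEN conjunct1, rule_format])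
  show "a \<in> carrier X \<Longrightarrow> B \<subseteq> carrier Y \<Longrightarrow> {a} \<times> B \<subseteq> D \<Longrightarrow> (a, \<Squnion>\<^bsub>Y\<^esub>B) \<in> D"
    by (rule D[THEN conjunct2, THEN conjunct2, THEN conjunct2, rule_format])
qed

lemma product_open_down:
  assumes D: "product_open X Y D" and ab: "(a, b) \<in> D" and "a' \<in> carrier X" "b' \<in> carrier Y"
    "a' \<sqsubseteq>\<^bsub>X\<^esub> a" "b' \<sqsubseteq>\<^bsub>Y\<^esub> b"
  shows "(a', b') \<in> D"
proof -
  have "a \<in> carrier X" "b \<in> carrier Y" using product_open_subset[OF D] ab by blast+
  then show ?thesis by (rule product_openD(2)[OF D, rule_format]) (rule assms)+
qed

lemma product_open_sup1:
  assumes "product_open X Y D" "A \<subseteq> carrier X" "b \<in> carrier Y" "\<forall>a\<in>A. (a, b) \<in> D"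
  shows "(\<Squnion>\<^bsub>X\<^esub>A, b) \<in> D"
proof -
  have "A \<times> {b} \<subseteq> D" using assms(4) by blast
  then show ?thesis by (rule product_openD(3)[OF assms(1-3)])
qed

lemma product_open_sup2:
  assumes "product_open X Y D" "a \<in> carrier X" "B \<subseteq> carrier Y" "\<forall>b\<in>B. (a, b) \<in> D"
  shows "(a, \<Squnion>\<^bsub>Y\<^esub>B) \<in> D"
proof -
  have "{a} \<times> B \<subseteq> D" using assms(4) by blast
  then show ?thesis by (rule product_openD(4)[OF assms(1-3)])
qed

lemma product_openI:
  assumes "D \<subseteq> carrier X \<times> carrier Y"
    and "\<And>a b a' b'. (a, b) \<in> D \<Longrightarrow> a \<in> carrier X \<Longrightarrow> b \<in> carrier Y \<Longrightarrow> a' \<in> carrier X \<Longrightarrow> b' \<in> carrier Y \<Longrightarrow>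
        a' \<sqsubseteq>\<^bsub>X\<^esub> a \<Longrightarrow> b' \<sqsubseteq>\<^bsub>Y\<^esub> b \<Longrightarrow> (a', b') \<in> D"
    and "\<And>A b. A \<subseteq> carrier X \<Longrightarrow> b \<in> carrier Y \<Longrightarrow> \<forall>a\<in>A. (a, b) \<in> D \<Longrightarrow> (\<Squnion>\<^bsub>X\<^esub>A, b) \<in> D"
    and "\<And>a B. a \<in> carrier X \<Longrightarrow> B \<subseteq> carrier Y \<Longrightarrow> \<forall>b\<in>B. (a, b) \<in> D \<Longrightarrow> (a, \<Squnion>\<^bsub>Y\<^esub>B) \<in> D"
  shows "product_open X Y D"
  unfolding product_open_def
proof (intro conjI allI ballI impI)
  fix A b assume A: "A \<subseteq> carrier X" and b: "b \<in> carrier Y" and "A \<times> {b} \<subseteq> D"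
  then have "\<forall>a\<in>A. (a, b) \<in> D" by blast
  then show "(\<Squnion>\<^bsub>X\<^esub>A, b) \<in> D" by (rule assms(3)[OF A b])
next
  fix a B assume a: "a \<in> carrier X" and B: "B \<subseteq> carrier Y" and "{a} \<times> B \<subseteq> D"
  then have "\<forall>b\<in>B. (a, b) \<in> D" by blast
  then show "(a, \<Squnion>\<^bsub>Y\<^esub>B) \<in> D" by (rule assms(4)[OF a B])
next
  fix a b a' b'
  assume "(a, b) \<in> D" "a \<in> carrier X" "b \<in> carrier Y" "a' \<in> carrier X" "b' \<in> carrier Y"
    "a' \<sqsubseteq>\<^bsub>X\<^esub> a" "b' \<sqsubseteq>\<^bsub>Y\<^esub> b"
  then show "(a', b') \<in> D" by (rule assms(2))
qed (rule assms(1))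

lemma product_open_bottom:
  assumes D: "product_open X Y D"
  shows "b \<in> carrier Y \<Longrightarrow> (\<bottom>\<^bsub>X\<^esub>, b) \<in> D" and "a \<in> carrier X \<Longrightarrow> (a, \<bottom>\<^bsub>Y\<^esub>) \<in> D"
  using product_open_sup1[OF D empty_subsetI, of b] product_open_sup2[OF D _ empty_subsetI, of a]
  unfolding X.sup_empty_eq Y.sup_empty_eq by simp_all

lemma product_open_Inter:
  assumes ne: "\<F> \<noteq> {}" and o: "\<And>D. D \<in> \<F> \<Longrightarrow> product_open X Y D"
  shows "product_open X Y (\<Inter>\<F>)"
proof (rule product_openI)
  obtain D where "D \<in> \<F>" using ne ex_in_conv by metis
  then have "\<Inter>\<F> \<subseteq> D" "D \<subseteq> carrier X \<times> carrier Y"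
    using Inter_lower[of D \<F>] product_open_subset[OF o] by simp_all
  then show "\<Inter>\<F> \<subseteq> carrier X \<times> carrier Y" by (rule subset_trans)
next
  fix a b a' b'
  assume m: "(a, b) \<in> \<Inter>\<F>" and ab: "a' \<in> carrier X" "b' \<in> carrier Y" "a' \<sqsubseteq>\<^bsub>X\<^esub> a" "b' \<sqsubseteq>\<^bsub>Y\<^esub> b"
  show "(a', b') \<in> \<Inter>\<F>"
    by (rule InterI) (rule product_open_down[OF o InterD[OF m] ab])
next
  fix A b assume A: "A \<subseteq> carrier X" and b: "b \<in> carrier Y" and m: "\<forall>a\<in>A. (a, b) \<in> \<Inter>\<F>"
  show "(\<Squnion>\<^bsub>X\<^esub>A, b) \<in> \<Inter>\<F>"
  proof (rule InterI)
    fix D assume D: "D \<in> \<F>"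
    have "\<forall>a\<in>A. (a, b) \<in> D" using m InterD[OF _ D] by simp
    then show "(\<Squnion>\<^bsub>X\<^esub>A, b) \<in> D" by (rule product_open_sup1[OF o[OF D] A b])
  qed
next
  fix a B assume a: "a \<in> carrier X" and B: "B \<subseteq> carrier Y" and m: "\<forall>b\<in>B. (a, b) \<in> \<Inter>\<F>"
  show "(a, \<Squnion>\<^bsub>Y\<^esub>B) \<in> \<Inter>\<F>"
  proof (rule InterI)
    fix D assume D: "D \<in> \<F>"
    have "\<forall>b\<in>B. (a, b) \<in> D" using m InterD[OF _ D] by simp
    then show "(a, \<Squnion>\<^bsub>Y\<^esub>B) \<in> D" by (rule product_open_sup2[OF o[OF D] a B])
  qed
qed

lemma product_open_full: "product_open X Y (carrier X \<times> carrier Y)"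
proof (rule product_openI)
  show "(\<Squnion>\<^bsub>X\<^esub>A, b) \<in> carrier X \<times> carrier Y" if "A \<subseteq> carrier X" "b \<in> carrier Y" for A b
    by (simp only: mem_Sigma_iff X.sup_closed that)
  show "(a, \<Squnion>\<^bsub>Y\<^esub>B) \<in> carrier X \<times> carrier Y" if "a \<in> carrier X" "B \<subseteq> carrier Y" for a B
    by (simp only: mem_Sigma_iff Y.sup_closed that)
qed (simp_all only: subset_refl mem_Sigma_iff)

lemma rectangle_iff: "(a, b) \<in> rectangle X Y U V \<longleftrightarrow> a \<in> carrier X \<and> b \<in> carrier Y \<and>
     ((a \<sqsubseteq>\<^bsub>X\<^esub> U \<and> b \<sqsubseteq>\<^bsub>Y\<^esub> V) \<or> a = \<bottom>\<^bsub>X\<^esub> \<or> b = \<bottom>\<^bsub>Y\<^esub>)"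
  by (simp only: rectangle_def mem_Collect_eq prod.case mem_Sigma_iff conj_assoc)

lemma rectangle_subset: "rectangle X Y U V \<subseteq> carrier X \<times> carrier Y"
  by (rule subrelI) (simp only: rectangle_iff mem_Sigma_iff)

lemma product_open_rectangle:
  assumes U: "U \<in> carrier X" and V: "V \<in> carrier Y"
  shows "product_open X Y (rectangle X Y U V)"
proof (rule product_openI)
  show "rectangle X Y U V \<subseteq> carrier X \<times> carrier Y" by (rule rectangle_subset)
next
  fix a b a' b'
  assume ab: "(a, b) \<in> rectangle X Y U V" "a \<in> carrier X" "b \<in> carrier Y"
    and a'b': "a' \<in> carrier X" "b' \<in> carrier Y" "a' \<sqsubseteq>\<^bsub>X\<^esub> a" "b' \<sqsubseteq>\<^bsub>Y\<^esub> b"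
  have "a' = \<bottom>\<^bsub>X\<^esub>" if "a = \<bottom>\<^bsub>X\<^esub>"
    using that a'b'(1,3) X.le_bottom_eq by simp
  moreover have "b' = \<bottom>\<^bsub>Y\<^esub>" if "b = \<bottom>\<^bsub>Y\<^esub>"
    using that a'b'(2,4) Y.le_bottom_eq by simp
  moreover have "a' \<sqsubseteq>\<^bsub>X\<^esub> U" if "a \<sqsubseteq>\<^bsub>X\<^esub> U" using X.le_trans[OF a'b'(3) that] a'b' ab U by simp
  moreover have "b' \<sqsubseteq>\<^bsub>Y\<^esub> V" if "b \<sqsubseteq>\<^bsub>Y\<^esub> V" using Y.le_trans[OF a'b'(4) that] a'b' ab V by simp
  ultimately show "(a', b') \<in> rectangle X Y U V"
    using ab(1) a'b'(1,2) unfolding rectangle_iff by blast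
next
  fix A b assume A: "A \<subseteq> carrier X" and b: "b \<in> carrier Y" and m: "\<forall>a\<in>A. (a, b) \<in> rectangle X Y U V"
  show "(\<Squnion>\<^bsub>X\<^esub>A, b) \<in> rectangle X Y U V"
  proof (cases "b = \<bottom>\<^bsub>Y\<^esub>")
    case True
    then show ?thesis using X.sup_closed[OF A] b unfolding rectangle_iff by simp
  next
    case False
    have "a \<sqsubseteq>\<^bsub>X\<^esub> U" if "a \<in> A" for a
      using m that False X.bottom_lower[OF U] unfolding rectangle_iff by auto
    then have l: "\<Squnion>\<^bsub>X\<^esub>A \<sqsubseteq>\<^bsub>X\<^esub> U" by (rule X.sup_least[OF A U])
    show ?thesis
    proof (cases "b \<sqsubseteq>\<^bsub>Y\<^esub> V")
      case True
      then show ?thesis using l X.sup_closed[OF A] b unfolding rectangle_iff by simp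
    next
      case nb: False
      have "a \<sqsubseteq>\<^bsub>X\<^esub> \<bottom>\<^bsub>X\<^esub>" if "a \<in> A" for a
        using m that False nb X.le_refl[OF X.bottom_closed] unfolding rectangle_iff by auto
      then have "\<Squnion>\<^bsub>X\<^esub>A \<sqsubseteq>\<^bsub>X\<^esub> \<bottom>\<^bsub>X\<^esub>" by (rule X.sup_least[OF A X.bottom_closed])
      then have "\<Squnion>\<^bsub>X\<^esub>A = \<bottom>\<^bsub>X\<^esub>"
        by (rule X.le_bottom_eq[OF X.sup_closed[OF A]])
      then show ?thesis using b unfolding rectangle_iff by simp
    qed
  qed
next
  fix a B assume a: "a \<in> carrier X" and B: "B \<subseteq> carrier Y" and m: "\<forall>b\<in>B. (a, b) \<in> rectangle X Y U V"
  show "(a, \<Squnion>\<^bsub>Y\<^esub>B) \<in> rectangle X Y U V"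
  proof (cases "a = \<bottom>\<^bsub>X\<^esub>")
    case True
    then show ?thesis using Y.sup_closed[OF B] a unfolding rectangle_iff by simp
  next
    case False
    have "b \<sqsubseteq>\<^bsub>Y\<^esub> V" if "b \<in> B" for b
      using m that False Y.bottom_lower[OF V] unfolding rectangle_iff by auto
    then have l: "\<Squnion>\<^bsub>Y\<^esub>B \<sqsubseteq>\<^bsub>Y\<^esub> V" by (rule Y.sup_least[OF B V])
    show ?thesis
    proof (cases "a \<sqsubseteq>\<^bsub>X\<^esub> U")
      case True
      then show ?thesis using l Y.sup_closed[OF B] a unfolding rectangle_iff by simp
    next
      case na: False
      have "b \<sqsubseteq>\<^bsub>Y\<^esub> \<bottom>\<^bsub>Y\<^esub>" if "b \<in> B" for b
        using m that False na Y.le_refl[OF Y.bottom_closed] unfolding rectangle_iff by auto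
      then have "\<Squnion>\<^bsub>Y\<^esub>B \<sqsubseteq>\<^bsub>Y\<^esub> \<bottom>\<^bsub>Y\<^esub>" by (rule Y.sup_least[OF B Y.bottom_closed])
      then have "\<Squnion>\<^bsub>Y\<^esub>B = \<bottom>\<^bsub>Y\<^esub>"
        by (rule Y.le_bottom_eq[OF Y.sup_closed[OF B]])
      then show ?thesis using a unfolding rectangle_iff by simp
    qed
  qed
qed

lemma rectangle_subset_iff:
  assumes U: "U \<in> carrier X" and V: "V \<in> carrier Y" and D: "product_open X Y D"
  shows "rectangle X Y U V \<subseteq> D \<longleftrightarrow> (U, V) \<in> D"
proof
  have "(U, V) \<in> rectangle X Y U V" using U V unfolding rectangle_iff by simp
  then show "rectangle X Y U V \<subseteq> D \<Longrightarrow> (U, V) \<in> D" by (rule rev_subsetD)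
  assume UV: "(U, V) \<in> D"
  show "rectangle X Y U V \<subseteq> D"
  proof (rule subrelI)
    fix a b assume ab: "(a, b) \<in> rectangle X Y U V"
    then have c: "a \<in> carrier X" "b \<in> carrier Y" unfolding rectangle_iff by simp_all
    consider "a \<sqsubseteq>\<^bsub>X\<^esub> U" "b \<sqsubseteq>\<^bsub>Y\<^esub> V" | "a = \<bottom>\<^bsub>X\<^esub>" | "b = \<bottom>\<^bsub>Y\<^esub>"
      using ab unfolding rectangle_iff by blast
    then show "(a, b) \<in> D"
    proof cases
      case 1 then show ?thesis by (rule product_open_down[OF D UV c])
    next
      case 2 then show ?thesis using product_open_bottom(1)[OF D c(2)] by simp
    next
      case 3 then show ?thesis using product_open_bottom(2)[OF D c(1)] by simp
    qed
  qed
qed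

lemma rectangle_Int:
  assumes "U \<in> carrier X" "U' \<in> carrier X" "V \<in> carrier Y" "V' \<in> carrier Y"
  shows "rectangle X Y U V \<inter> rectangle X Y U' V' = rectangle X Y (U \<sqinter>\<^bsub>X\<^esub> U') (V \<sqinter>\<^bsub>Y\<^esub> V')"
proof -
  have 1: "a \<sqsubseteq>\<^bsub>X\<^esub> U \<sqinter>\<^bsub>X\<^esub> U' \<longleftrightarrow> a \<sqsubseteq>\<^bsub>X\<^esub> U \<and> a \<sqsubseteq>\<^bsub>X\<^esub> U'" if "a \<in> carrier X" for a
    using that assms X.meet_le[of a U U'] X.le_trans[OF _ X.meet_left[of U U'], of a]
      X.le_trans[OF _ X.meet_right[of U U'], of a] by auto
  have 2: "b \<sqsubseteq>\<^bsub>Y\<^esub> V \<sqinter>\<^bsub>Y\<^esub> V' \<longleftrightarrow> b \<sqsubseteq>\<^bsub>Y\<^esub> V \<and> b \<sqsubseteq>\<^bsub>Y\<^esub> V'" if "b \<in> carrier Y" for b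
    using that assms Y.meet_le[of b V V'] Y.le_trans[OF _ Y.meet_left[of V V'], of b]
      Y.le_trans[OF _ Y.meet_right[of V V'], of b] by auto
  show ?thesis
  proof (rule Set.set_eqI)
    fix p :: "'a \<times> 'b"
    obtain a b where p: "p = (a, b)" by (rule prod.exhaust)
    show "p \<in> rectangle X Y U V \<inter> rectangle X Y U' V' \<longleftrightarrow>
        p \<in> rectangle X Y (U \<sqinter>\<^bsub>X\<^esub> U') (V \<sqinter>\<^bsub>Y\<^esub> V')"
      unfolding p Int_iff rectangle_iff using 1[of a] 2[of b] by argo
  qed
qed

definition product_hull :: "('a \<times> 'b) set set \<Rightarrow> ('a \<times> 'b) set" where
  "product_hull \<D> = \<Inter>{K. product_open X Y K \<and> \<Union>\<D> \<subseteq> K}"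

lemma product_hull:
  assumes "\<forall>D\<in>\<D>. product_open X Y D"
  shows "product_open X Y (product_hull \<D>)"
    and "D \<in> \<D> \<Longrightarrow> D \<subseteq> product_hull \<D>"
    and "product_open X Y K \<Longrightarrow> \<forall>D\<in>\<D>. D \<subseteq> K \<Longrightarrow> product_hull \<D> \<subseteq> K"
proof -
  have "carrier X \<times> carrier Y \<in> {K. product_open X Y K \<and> \<Union>\<D> \<subseteq> K}"
    using assms product_open_subset product_open_full by blast
  then have ne: "{K. product_open X Y K \<and> \<Union>\<D> \<subseteq> K} \<noteq> {}" by blast
  show "product_open X Y (product_hull \<D>)"
    unfolding product_hull_def by (rule product_open_Inter[OF ne]) blast
  show "D \<in> \<D> \<Longrightarrow> D \<subseteq> product_hull \<D>" unfolding product_hull_def by blast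
  show "product_open X Y K \<Longrightarrow> \<forall>D\<in>\<D>. D \<subseteq> K \<Longrightarrow> product_hull \<D> \<subseteq> K"
    unfolding product_hull_def by blast
qed

lemma product_open_imp:
  assumes D: "product_open X Y D" and K: "product_open X Y K"
  defines "I \<equiv> {(a, b) \<in> carrier X \<times> carrier Y. D \<inter> rectangle X Y a b \<subseteq> K}"
  shows "product_open X Y I"
proof -
  have DK: "product_open X Y D" "product_open X Y K" by (rule D, rule K)
  have I_iff: "(a, b) \<in> I \<longleftrightarrow> a \<in> carrier X \<and> b \<in> carrier Y \<and>
      (\<forall>a'\<in>carrier X. \<forall>b'\<in>carrier Y. (a', b') \<in> D \<longrightarrow> a' \<sqsubseteq>\<^bsub>X\<^esub> a \<longrightarrow> b' \<sqsubseteq>\<^bsub>Y\<^esub> b \<longrightarrow> (a', b') \<in> K)" for a b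
  proof -
    have "D \<inter> rectangle X Y a b \<subseteq> K \<longleftrightarrow>
      (\<forall>a' b'. (a', b') \<in> D \<and> (a', b') \<in> rectangle X Y a b \<longrightarrow> (a', b') \<in> K)"
      by (simp only: subset_iff split_paired_All Int_iff)
    then show ?thesis
      unfolding I_def rectangle_iff mem_Collect_eq prod.case mem_Sigma_iff
      using product_open_bottom[OF K] by metis
  qed
  show ?thesis
  proof (rule product_openI)
    show "I \<subseteq> carrier X \<times> carrier Y" by (rule subrelI) (simp only: I_iff mem_Sigma_iff)
  next
    fix a b a' b'
    assume ab: "(a, b) \<in> I" and c: "a \<in> carrier X" "b \<in> carrier Y" "a' \<in> carrier X" "b' \<in> carrier Y"
      and le: "a' \<sqsubseteq>\<^bsub>X\<^esub> a" "b' \<sqsubseteq>\<^bsub>Y\<^esub> b"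
    show "(a', b') \<in> I"
      unfolding I_iff
    proof (intro conjI ballI impI c)
      fix x y assume "x \<in> carrier X" "y \<in> carrier Y" "(x, y) \<in> D" "x \<sqsubseteq>\<^bsub>X\<^esub> a'" "y \<sqsubseteq>\<^bsub>Y\<^esub> b'"
      then show "(x, y) \<in> K"
        using ab X.le_trans[OF _ le(1)] Y.le_trans[OF _ le(2)] c unfolding I_iff by blast
    qed
  next
    fix A b assume A: "A \<subseteq> carrier X" and b: "b \<in> carrier Y" and m: "\<forall>a\<in>A. (a, b) \<in> I"
    show "(\<Squnion>\<^bsub>X\<^esub>A, b) \<in> I"
      unfolding I_iff
    proof (intro conjI ballI impI b X.sup_closed A)
      fix x y assume x: "x \<in> carrier X" and y: "y \<in> carrier Y" and xy: "(x, y) \<in> D"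
        and le: "x \<sqsubseteq>\<^bsub>X\<^esub> \<Squnion>\<^bsub>X\<^esub>A" "y \<sqsubseteq>\<^bsub>Y\<^esub> b"
      have im: "(\<lambda>a. x \<sqinter>\<^bsub>X\<^esub> a) ` A \<subseteq> carrier X" using x A by auto
      have "x = x \<sqinter>\<^bsub>X\<^esub> \<Squnion>\<^bsub>X\<^esub>A" using X.le_iff_meet_eq[OF x X.sup_closed[OF A]] le by simp
      then have xe: "x = \<Squnion>\<^bsub>X\<^esub>((\<lambda>a. x \<sqinter>\<^bsub>X\<^esub> a) ` A)" using X.meet_sup_distrib[OF x A] by simp
      have "(x \<sqinter>\<^bsub>X\<^esub> a, y) \<in> K" if a: "a \<in> A" for a
      proof -
        have ac: "a \<in> carrier X" using a A by blast
        have xa: "x \<sqinter>\<^bsub>X\<^esub> a \<in> carrier X" using x ac by simp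
        have "(x \<sqinter>\<^bsub>X\<^esub> a, y) \<in> D"
          by (rule product_open_down[OF D xy xa y X.meet_left[OF x ac] Y.le_refl[OF y]])
        then show ?thesis using m a xa y X.meet_right[OF x ac] le(2) unfolding I_iff by blast
      qed
      then have "(\<Squnion>\<^bsub>X\<^esub>((\<lambda>a. x \<sqinter>\<^bsub>X\<^esub> a) ` A), y) \<in> K" by (intro product_open_sup1[OF K im y]) blast
      then show "(x, y) \<in> K" using xe by simp
    qed
  next
    fix a B assume a: "a \<in> carrier X" and B: "B \<subseteq> carrier Y" and m: "\<forall>b\<in>B. (a, b) \<in> I"
    show "(a, \<Squnion>\<^bsub>Y\<^esub>B) \<in> I"
      unfolding I_iff
    proof (intro conjI ballI impI a Y.sup_closed B)
      fix x y assume x: "x \<in> carrier X" and y: "y \<in> carrier Y" and xy: "(x, y) \<in> D"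
        and le: "x \<sqsubseteq>\<^bsub>X\<^esub> a" "y \<sqsubseteq>\<^bsub>Y\<^esub> \<Squnion>\<^bsub>Y\<^esub>B"
      have im: "(\<lambda>b. y \<sqinter>\<^bsub>Y\<^esub> b) ` B \<subseteq> carrier Y" using y B by auto
      have "y = y \<sqinter>\<^bsub>Y\<^esub> \<Squnion>\<^bsub>Y\<^esub>B" using Y.le_iff_meet_eq[OF y Y.sup_closed[OF B]] le by simp
      then have ye: "y = \<Squnion>\<^bsub>Y\<^esub>((\<lambda>b. y \<sqinter>\<^bsub>Y\<^esub> b) ` B)" using Y.meet_sup_distrib[OF y B] by simp
      have "(x, y \<sqinter>\<^bsub>Y\<^esub> b) \<in> K" if b: "b \<in> B" for b
      proof -
        have bc: "b \<in> carrier Y" using b B by blast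
        have yb: "y \<sqinter>\<^bsub>Y\<^esub> b \<in> carrier Y" using y bc by simp
        have "(x, y \<sqinter>\<^bsub>Y\<^esub> b) \<in> D"
          by (rule product_open_down[OF D xy x yb X.le_refl[OF x] Y.meet_left[OF y bc]])
        then show ?thesis using m b yb x Y.meet_right[OF y bc] le(1) unfolding I_iff by blast
      qed
      then have "(x, \<Squnion>\<^bsub>Y\<^esub>((\<lambda>b. y \<sqinter>\<^bsub>Y\<^esub> b) ` B)) \<in> K" by (intro product_open_sup2[OF K x im]) blast
      then show "(x, y) \<in> K" using ye by simp
    qed
  qed
qed

lemma product_carrier: "D \<in> carrier (product X Y) \<longleftrightarrow> product_open X Y D"
  and product_le: "D \<sqsubseteq>\<^bsub>product X Y\<^esub> E \<longleftrightarrow> D \<subseteq> E"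
  by (simp_all add: product_def)

lemma product_partial_order: "partial_order (product X Y)"
  by unfold_locales (auto simp: product_def)

lemma product_Int_hull:
  assumes D: "product_open X Y D" and \<E>: "\<forall>E\<in>\<E>. product_open X Y E"
  shows "D \<inter> product_hull \<E> \<subseteq> product_hull ((\<inter>) D ` \<E>)"
proof -
  have DE: "\<forall>E\<in>(\<inter>) D ` \<E>. product_open X Y E"
    using product_open_Inter[of "{D, E}" for E] D \<E> by auto
  let ?K = "product_hull ((\<inter>) D ` \<E>)"
  note K = product_hull[OF DE]
  let ?I = "{(a, b) \<in> carrier X \<times> carrier Y. D \<inter> rectangle X Y a b \<subseteq> ?K}"
  have "E \<subseteq> ?I" if E: "E \<in> \<E>" for E
  proof (rule subrelI)
    fix a b assume ab: "(a, b) \<in> E"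
    have Eo: "product_open X Y E" using \<E> E by blast
    have c: "a \<in> carrier X" "b \<in> carrier Y" using product_open_subset[OF Eo] ab by blast+
    have "rectangle X Y a b \<subseteq> E" using rectangle_subset_iff[OF c Eo] ab by blast
    moreover have "D \<inter> E \<subseteq> ?K" using K(2) E by blast
    ultimately show "(a, b) \<in> ?I" using c by blast
  qed
  then have "product_hull \<E> \<subseteq> ?I"
    by (intro product_hull(3)[OF \<E> product_open_imp[OF D K(1)]]) blast
  moreover have "(a, b) \<in> rectangle X Y a b" if "a \<in> carrier X" "b \<in> carrier Y" for a b
    using that unfolding rectangle_iff by simp
  ultimately show ?thesis by blast
qed

lemma product_frame: "frame (product X Y)"
  and product_sup: "\<And>\<D>. \<D> \<subseteq> carrier (product X Y) \<Longrightarrow> \<Squnion>\<^bsub>product X Y\<^esub>\<D> = product_hull \<D>"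
  and product_meet: "\<And>D E. D \<in> carrier (product X Y) \<Longrightarrow> E \<in> carrier (product X Y) \<Longrightarrow>
        D \<sqinter>\<^bsub>product X Y\<^esub> E = D \<inter> E"
proof -
  have Int: "product_open X Y (D \<inter> E)" if "product_open X Y D" "product_open X Y E" for D E
    using product_open_Inter[of "{D, E}"] that by auto
  have hull: "\<forall>D\<in>\<D>. product_open X Y D" if "\<D> \<subseteq> carrier (product X Y)" for \<D>
    using that product_carrier by blast
  note fI = frameI[OF product_partial_order, where S = product_hull and M = "(\<inter>)",
      unfolded product_carrier product_le]
  have S1: "product_open X Y (product_hull \<D>)" if "\<D> \<subseteq> carrier (product X Y)" for \<D>
    by (rule product_hull(1)[OF hull[OF that]])
  have S2: "D \<subseteq> product_hull \<D>" if "\<D> \<subseteq> carrier (product X Y)" "D \<in> \<D>" for \<D> D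
    by (rule product_hull(2)[OF hull[OF that(1)] that(2)])
  have S3: "product_hull \<D> \<subseteq> K"
    if "\<D> \<subseteq> carrier (product X Y)" "product_open X Y K" "\<And>D. D \<in> \<D> \<Longrightarrow> D \<subseteq> K" for \<D> K
    using that(3) by (intro product_hull(3)[OF hull[OF that(1)] that(2)] ballI)
  have dist: "D \<inter> product_hull \<E> \<subseteq> product_hull ((\<inter>) D ` \<E>)"
    if "product_open X Y D" "\<E> \<subseteq> carrier (product X Y)" for D \<E>
    by (rule product_Int_hull[OF that(1) hull[OF that(2)]])
  show "frame (product X Y)"
    by (rule fI(1)) (fact S1 S2 S3 Int dist | rule Int_lower1 Int_lower2 | rule Int_greatest, assumption+)+
  show "\<Squnion>\<^bsub>product X Y\<^esub>\<D> = product_hull \<D>" if "\<D> \<subseteq> carrier (product X Y)" for \<D>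
    by (rule fI(2)) (fact that S1 S2 S3 Int dist | rule Int_lower1 Int_lower2 | rule Int_greatest, assumption+)+
  show "D \<sqinter>\<^bsub>product X Y\<^esub> E = D \<inter> E"
    if "D \<in> carrier (product X Y)" "E \<in> carrier (product X Y)" for D E
    by (rule fI(3)) (fact that[unfolded product_carrier] S1 S2 S3 Int dist |
      rule Int_lower1 Int_lower2 | rule Int_greatest, assumption+)+
qed

lemma product_top: "\<top>\<^bsub>product X Y\<^esub> = carrier X \<times> carrier Y"
  using product_open_full product_open_subset
  by (intro top_eqI product_frame) (auto simp: product_carrier product_le)

lemma rectangle_top: "rectangle X Y \<top>\<^bsub>X\<^esub> \<top>\<^bsub>Y\<^esub> = carrier X \<times> carrier Y"
  using rectangle_subset by (rule subset_antisym) (auto simp: rectangle_iff)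

lemma meet_idem: "\<top>\<^bsub>X\<^esub> \<sqinter>\<^bsub>X\<^esub> \<top>\<^bsub>X\<^esub> = \<top>\<^bsub>X\<^esub>" "\<top>\<^bsub>Y\<^esub> \<sqinter>\<^bsub>Y\<^esub> \<top>\<^bsub>Y\<^esub> = \<top>\<^bsub>Y\<^esub>"
  using X.le_iff_meet_eq[OF X.top_closed X.top_closed] Y.le_iff_meet_eq[OF Y.top_closed Y.top_closed] by simp_all

lemma locale_map_pr1: "locale_map (product X Y) X (pr1 X Y)"
  unfolding locale_map_def frame_map_def
proof (intro conjI ballI allI impI)
  have o: "product_open X Y (pr1 X Y U)" if "U \<in> carrier X" for U
    unfolding pr1_def by (rule product_open_rectangle[OF that Y.top_closed])
  then show "pr1 X Y \<in> carrier X \<rightarrow> carrier (product X Y)" by (auto simp: product_carrier)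
  show "pr1 X Y \<top>\<^bsub>X\<^esub> = \<top>\<^bsub>product X Y\<^esub>" unfolding pr1_def rectangle_top product_top ..
  show "pr1 X Y (U \<sqinter>\<^bsub>X\<^esub> U') = pr1 X Y U \<sqinter>\<^bsub>product X Y\<^esub> pr1 X Y U'" if "U \<in> carrier X" "U' \<in> carrier X" for U U'
    using that o product_meet[of "pr1 X Y U" "pr1 X Y U'"]
      rectangle_Int[OF that Y.top_closed Y.top_closed] by (simp add: product_carrier pr1_def meet_idem)
  fix A assume A: "A \<subseteq> carrier X"
  have c: "pr1 X Y ` A \<subseteq> carrier (product X Y)" using A o by (auto simp: product_carrier)
  have o': "\<forall>D\<in>pr1 X Y ` A. product_open X Y D" using A o by blast
  note h = product_hull[OF o']
  have s: "\<Squnion>\<^bsub>X\<^esub>A \<in> carrier X" by (rule X.sup_closed[OF A])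
  have m: "(U, \<top>\<^bsub>Y\<^esub>) \<in> pr1 X Y U" if "U \<in> carrier X" for U
    using that unfolding pr1_def rectangle_iff by simp
  show "pr1 X Y (\<Squnion>\<^bsub>X\<^esub>A) = \<Squnion>\<^bsub>product X Y\<^esub>(pr1 X Y ` A)"
    unfolding product_sup[OF c]
  proof
    have "(a, \<top>\<^bsub>Y\<^esub>) \<in> product_hull (pr1 X Y ` A)" if a: "a \<in> A" for a
      by (rule subsetD[OF h(2)[OF imageI[OF a]] m[OF subsetD[OF A a]]])
    then have "(\<Squnion>\<^bsub>X\<^esub>A, \<top>\<^bsub>Y\<^esub>) \<in> product_hull (pr1 X Y ` A)"
      by (intro product_open_sup1[OF h(1) A Y.top_closed] ballI)
    then show "pr1 X Y (\<Squnion>\<^bsub>X\<^esub>A) \<subseteq> product_hull (pr1 X Y ` A)"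
      unfolding pr1_def rectangle_subset_iff[OF s Y.top_closed h(1)[unfolded pr1_def]] .
    have "pr1 X Y a \<subseteq> pr1 X Y (\<Squnion>\<^bsub>X\<^esub>A)" if a: "a \<in> A" for a
    proof -
      have ac: "a \<in> carrier X" using a A by blast
      have "(a, \<top>\<^bsub>Y\<^esub>) \<in> pr1 X Y (\<Squnion>\<^bsub>X\<^esub>A)"
        using X.sup_upper[OF A a] ac unfolding pr1_def rectangle_iff by simp
      then show ?thesis
        using rectangle_subset_iff[OF ac Y.top_closed o[OF s]] unfolding pr1_def by simp
    qed
    then show "product_hull (pr1 X Y ` A) \<subseteq> pr1 X Y (\<Squnion>\<^bsub>X\<^esub>A)" by (intro h(3) o s) blast
  qed
qed

lemma locale_map_pr2: "locale_map (product X Y) Y (pr2 X Y)"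
  unfolding locale_map_def frame_map_def
proof (intro conjI ballI allI impI)
  have o: "product_open X Y (pr2 X Y V)" if "V \<in> carrier Y" for V
    unfolding pr2_def by (rule product_open_rectangle[OF X.top_closed that])
  then show "pr2 X Y \<in> carrier Y \<rightarrow> carrier (product X Y)" by (auto simp: product_carrier)
  show "pr2 X Y \<top>\<^bsub>Y\<^esub> = \<top>\<^bsub>product X Y\<^esub>" unfolding pr2_def rectangle_top product_top ..
  show "pr2 X Y (V \<sqinter>\<^bsub>Y\<^esub> V') = pr2 X Y V \<sqinter>\<^bsub>product X Y\<^esub> pr2 X Y V'" if "V \<in> carrier Y" "V' \<in> carrier Y" for V V'
    using that o product_meet[of "pr2 X Y V" "pr2 X Y V'"]
      rectangle_Int[OF X.top_closed X.top_closed that] by (simp add: product_carrier pr2_def meet_idem)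
  fix B assume B: "B \<subseteq> carrier Y"
  have c: "pr2 X Y ` B \<subseteq> carrier (product X Y)" using B o by (auto simp: product_carrier)
  have o': "\<forall>D\<in>pr2 X Y ` B. product_open X Y D" using B o by blast
  note h = product_hull[OF o']
  have s: "\<Squnion>\<^bsub>Y\<^esub>B \<in> carrier Y" by (rule Y.sup_closed[OF B])
  have m: "(\<top>\<^bsub>X\<^esub>, V) \<in> pr2 X Y V" if "V \<in> carrier Y" for V
    using that unfolding pr2_def rectangle_iff by simp
  show "pr2 X Y (\<Squnion>\<^bsub>Y\<^esub>B) = \<Squnion>\<^bsub>product X Y\<^esub>(pr2 X Y ` B)"
    unfolding product_sup[OF c]
  proof
    have "(\<top>\<^bsub>X\<^esub>, b) \<in> product_hull (pr2 X Y ` B)" if b: "b \<in> B" for b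
      by (rule subsetD[OF h(2)[OF imageI[OF b]] m[OF subsetD[OF B b]]])
    then have "(\<top>\<^bsub>X\<^esub>, \<Squnion>\<^bsub>Y\<^esub>B) \<in> product_hull (pr2 X Y ` B)"
      by (intro product_open_sup2[OF h(1) X.top_closed B] ballI)
    then show "pr2 X Y (\<Squnion>\<^bsub>Y\<^esub>B) \<subseteq> product_hull (pr2 X Y ` B)"
      unfolding pr2_def rectangle_subset_iff[OF X.top_closed s h(1)[unfolded pr2_def]] .
    have "pr2 X Y b \<subseteq> pr2 X Y (\<Squnion>\<^bsub>Y\<^esub>B)" if b: "b \<in> B" for b
    proof -
      have bc: "b \<in> carrier Y" using b B by blast
      have "(\<top>\<^bsub>X\<^esub>, b) \<in> pr2 X Y (\<Squnion>\<^bsub>Y\<^esub>B)"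
        using Y.sup_upper[OF B b] bc unfolding pr2_def rectangle_iff by simp
      then show ?thesis
        using rectangle_subset_iff[OF X.top_closed bc o[OF s]] unfolding pr2_def by simp
    qed
    then show "product_hull (pr2 X Y ` B) \<subseteq> pr2 X Y (\<Squnion>\<^bsub>Y\<^esub>B)" by (intro h(3) o s) blast
  qed
qed

lemma product_universal:
  fixes Z :: "'z gorder"
  assumes Z: "frame Z" and f: "locale_map Z X f" and g: "locale_map Z Y g"
  shows "locale_map Z (product X Y) (pairing Z f g)"
    and "U \<in> carrier X \<Longrightarrow> pairing Z f g (pr1 X Y U) = f U"
    and "V \<in> carrier Y \<Longrightarrow> pairing Z f g (pr2 X Y V) = g V"
    and "locale_map Z (product X Y) h \<Longrightarrow> \<forall>U\<in>carrier X. h (pr1 X Y U) = f U \<Longrightarrow>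
          \<forall>V\<in>carrier Y. h (pr2 X Y V) = g V \<Longrightarrow> D \<in> carrier (product X Y) \<Longrightarrow> h D = pairing Z f g D"
proof -
  interpret Z: frame Z by (rule Z)
  interpret P: frame "product X Y" by (rule product_frame)
  have f: "frame_map X Z f" and g: "frame_map Y Z g" using f g by (simp_all add: locale_map_def)
  note fc = frame_map_closed[OF f] and gc = frame_map_closed[OF g]
  have fg: "f a \<sqinter>\<^bsub>Z\<^esub> g b \<in> carrier Z" if "a \<in> carrier X" "b \<in> carrier Y" for a b
    using fc[OF that(1)] gc[OF that(2)] by simp
  have set: "{f a \<sqinter>\<^bsub>Z\<^esub> g b |a b. (a, b) \<in> D} \<subseteq> carrier Z" if "product_open X Y D" for D
    using product_open_subset[OF that] fg by blast
  have pc: "pairing Z f g D \<in> carrier Z" if "product_open X Y D" for D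
    unfolding pairing_def by (rule Z.sup_closed[OF set[OF that]])
  have upper: "f a \<sqinter>\<^bsub>Z\<^esub> g b \<sqsubseteq>\<^bsub>Z\<^esub> pairing Z f g D" if "product_open X Y D" "(a, b) \<in> D" for a b D
    unfolding pairing_def using that(2) by (intro Z.sup_upper[OF set[OF that(1)]]) blast
  have least: "pairing Z f g D \<sqsubseteq>\<^bsub>Z\<^esub> z"
    if "product_open X Y D" "z \<in> carrier Z" "\<forall>(a, b)\<in>D. f a \<sqinter>\<^bsub>Z\<^esub> g b \<sqsubseteq>\<^bsub>Z\<^esub> z" for z D
    unfolding pairing_def using that(3) by (intro Z.sup_least[OF set[OF that(1)] that(2)]) blast
  have meet_mono: "x \<sqinter>\<^bsub>Z\<^esub> y \<sqsubseteq>\<^bsub>Z\<^esub> x' \<sqinter>\<^bsub>Z\<^esub> y'"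
    if "x \<in> carrier Z" "y \<in> carrier Z" "x' \<in> carrier Z" "y' \<in> carrier Z" "x \<sqsubseteq>\<^bsub>Z\<^esub> x'" "y \<sqsubseteq>\<^bsub>Z\<^esub> y'" for x y x' y'
    using that Z.le_trans[OF Z.meet_left[OF that(1,2)] that(5)] Z.le_trans[OF Z.meet_right[OF that(1,2)] that(6)]
    by (intro Z.meet_le) simp_all
  have fg_mono: "f a' \<sqinter>\<^bsub>Z\<^esub> g b' \<sqsubseteq>\<^bsub>Z\<^esub> f a \<sqinter>\<^bsub>Z\<^esub> g b"
    if "a \<in> carrier X" "b \<in> carrier Y" "a' \<in> carrier X" "b' \<in> carrier Y" "a' \<sqsubseteq>\<^bsub>X\<^esub> a" "b' \<sqsubseteq>\<^bsub>Y\<^esub> b" for a b a' b'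
    using frame_map_mono[OF X Z f that(3,1,5)] frame_map_mono[OF Y Z g that(4,2,6)] that fc gc
    by (intro meet_mono) simp_all
  have fg_open: "product_open X Y {(a, b) \<in> carrier X \<times> carrier Y. f a \<sqinter>\<^bsub>Z\<^esub> g b \<sqsubseteq>\<^bsub>Z\<^esub> z}" (is "product_open X Y ?D")
    if z: "z \<in> carrier Z" for z
  proof (rule product_openI)
    show "?D \<subseteq> carrier X \<times> carrier Y" by blast
  next
    fix a b a' b'
    assume "(a, b) \<in> ?D" and c: "a \<in> carrier X" "b \<in> carrier Y" "a' \<in> carrier X" "b' \<in> carrier Y"
      and le: "a' \<sqsubseteq>\<^bsub>X\<^esub> a" "b' \<sqsubseteq>\<^bsub>Y\<^esub> b"
    then have "f a \<sqinter>\<^bsub>Z\<^esub> g b \<sqsubseteq>\<^bsub>Z\<^esub> z" by blast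
    then have "f a' \<sqinter>\<^bsub>Z\<^esub> g b' \<sqsubseteq>\<^bsub>Z\<^esub> z"
      by (rule Z.le_trans[OF fg_mono[OF c le] _ fg[OF c(3,4)] fg[OF c(1,2)] z])
    then show "(a', b') \<in> ?D" using c by blast
  next
    fix A b assume A: "A \<subseteq> carrier X" and b: "b \<in> carrier Y" and m: "\<forall>a\<in>A. (a, b) \<in> ?D"
    have fA: "f ` A \<subseteq> carrier Z" using A fc by blast
    have "\<forall>y\<in>f ` A. g b \<sqinter>\<^bsub>Z\<^esub> y \<sqsubseteq>\<^bsub>Z\<^esub> z" using m by (auto simp: meet_comm[of Z "g b"])
    then have "g b \<sqinter>\<^bsub>Z\<^esub> \<Squnion>\<^bsub>Z\<^esub>(f ` A) \<sqsubseteq>\<^bsub>Z\<^esub> z" unfolding Z.meet_sup_le_iff[OF gc[OF b] fA z] .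
    then have "f (\<Squnion>\<^bsub>X\<^esub>A) \<sqinter>\<^bsub>Z\<^esub> g b \<sqsubseteq>\<^bsub>Z\<^esub> z" unfolding frame_map_sup[OF f A] by (simp only: meet_comm)
    then show "(\<Squnion>\<^bsub>X\<^esub>A, b) \<in> ?D" using X.sup_closed[OF A] b by blast
  next
    fix a B assume a: "a \<in> carrier X" and B: "B \<subseteq> carrier Y" and m: "\<forall>b\<in>B. (a, b) \<in> ?D"
    have gB: "g ` B \<subseteq> carrier Z" using B gc by blast
    have "\<forall>y\<in>g ` B. f a \<sqinter>\<^bsub>Z\<^esub> y \<sqsubseteq>\<^bsub>Z\<^esub> z" using m by blast
    then have "f a \<sqinter>\<^bsub>Z\<^esub> g (\<Squnion>\<^bsub>Y\<^esub>B) \<sqsubseteq>\<^bsub>Z\<^esub> z"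
      unfolding frame_map_sup[OF g B] Z.meet_sup_le_iff[OF fc[OF a] gB z] .
    then show "(a, \<Squnion>\<^bsub>Y\<^esub>B) \<in> ?D" using Y.sup_closed[OF B] a by blast
  qed
  have rect: "pairing Z f g (rectangle X Y U V) = f U \<sqinter>\<^bsub>Z\<^esub> g V" if U: "U \<in> carrier X" and V: "V \<in> carrier Y" for U V
  proof (rule Z.le_antisym)
    note o = product_open_rectangle[OF U V]
    have "(U, V) \<in> {(a, b) \<in> carrier X \<times> carrier Y. f a \<sqinter>\<^bsub>Z\<^esub> g b \<sqsubseteq>\<^bsub>Z\<^esub> f U \<sqinter>\<^bsub>Z\<^esub> g V}"
      using U V Z.le_refl[OF fg[OF U V]] by simp
    then have "rectangle X Y U V \<subseteq> {(a, b) \<in> carrier X \<times> carrier Y. f a \<sqinter>\<^bsub>Z\<^esub> g b \<sqsubseteq>\<^bsub>Z\<^esub> f U \<sqinter>\<^bsub>Z\<^esub> g V}"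
      unfolding rectangle_subset_iff[OF U V fg_open[OF fg[OF U V]]] .
    then show "pairing Z f g (rectangle X Y U V) \<sqsubseteq>\<^bsub>Z\<^esub> f U \<sqinter>\<^bsub>Z\<^esub> g V"
      by (intro least[OF o fg[OF U V]]) blast
    have "(U, V) \<in> rectangle X Y U V" using U V unfolding rectangle_iff by simp
    then show "f U \<sqinter>\<^bsub>Z\<^esub> g V \<sqsubseteq>\<^bsub>Z\<^esub> pairing Z f g (rectangle X Y U V)" by (rule upper[OF o])
    show "pairing Z f g (rectangle X Y U V) \<in> carrier Z" by (rule pc[OF o])
    show "f U \<sqinter>\<^bsub>Z\<^esub> g V \<in> carrier Z" by (rule fg[OF U V])
  qed
  have mt: "x \<sqinter>\<^bsub>Z\<^esub> \<top>\<^bsub>Z\<^esub> = x" "\<top>\<^bsub>Z\<^esub> \<sqinter>\<^bsub>Z\<^esub> x = x" if x: "x \<in> carrier Z" for x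
    using Z.le_iff_meet_eq[OF x Z.top_closed] Z.top_higher[OF x] meet_comm[of Z x] by simp_all
  show p1: "pairing Z f g (pr1 X Y U) = f U" if "U \<in> carrier X" for U
    unfolding pr1_def rect[OF that Y.top_closed] frame_map_top[OF g] by (rule mt(1)[OF fc[OF that]])
  show p2: "pairing Z f g (pr2 X Y V) = g V" if "V \<in> carrier Y" for V
    unfolding pr2_def rect[OF X.top_closed that] frame_map_top[OF f] by (rule mt(2)[OF gc[OF that]])
  show "locale_map Z (product X Y) (pairing Z f g)"
    unfolding locale_map_def frame_map_def
  proof (intro conjI ballI allI impI)
    show "pairing Z f g \<in> carrier (product X Y) \<rightarrow> carrier Z" using pc by (simp add: product_carrier)
    show "pairing Z f g \<top>\<^bsub>product X Y\<^esub> = \<top>\<^bsub>Z\<^esub>"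
      unfolding product_top rectangle_top[symmetric] rect[OF X.top_closed Y.top_closed]
        frame_map_top[OF f] frame_map_top[OF g] by (rule mt(1)[OF Z.top_closed])
  next
    fix D E assume "D \<in> carrier (product X Y)" and "E \<in> carrier (product X Y)"
    then have D: "product_open X Y D" and E: "product_open X Y E"
      and DE: "D \<sqinter>\<^bsub>product X Y\<^esub> E = D \<inter> E" by (simp_all add: product_carrier product_meet)
    have DEo: "product_open X Y (D \<inter> E)" using product_open_Inter[of "{D, E}"] D E by auto
    show "pairing Z f g (D \<sqinter>\<^bsub>product X Y\<^esub> E) = pairing Z f g D \<sqinter>\<^bsub>Z\<^esub> pairing Z f g E"
      unfolding DE
    proof (rule Z.le_antisym)
      have "pairing Z f g (D \<inter> E) \<sqsubseteq>\<^bsub>Z\<^esub> pairing Z f g D" "pairing Z f g (D \<inter> E) \<sqsubseteq>\<^bsub>Z\<^esub> pairing Z f g E"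
        using upper[OF D] upper[OF E] by (auto intro!: least[OF DEo] pc D E)
      then show "pairing Z f g (D \<inter> E) \<sqsubseteq>\<^bsub>Z\<^esub> pairing Z f g D \<sqinter>\<^bsub>Z\<^esub> pairing Z f g E"
        by (rule Z.meet_le) (rule pc[OF D] pc[OF E] pc[OF DEo])+
      have key: "(f a \<sqinter>\<^bsub>Z\<^esub> g b) \<sqinter>\<^bsub>Z\<^esub> (f c \<sqinter>\<^bsub>Z\<^esub> g d) \<sqsubseteq>\<^bsub>Z\<^esub> pairing Z f g (D \<inter> E)"
        if ab: "(a, b) \<in> D" and cd: "(c, d) \<in> E" for a b c d
      proof -
        have c: "a \<in> carrier X" "b \<in> carrier Y" "c \<in> carrier X" "d \<in> carrier Y"
          using ab cd product_open_subset[OF D] product_open_subset[OF E] by blast+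
        have ac: "a \<sqinter>\<^bsub>X\<^esub> c \<in> carrier X" and bd: "b \<sqinter>\<^bsub>Y\<^esub> d \<in> carrier Y" using c by simp_all
        have "(a \<sqinter>\<^bsub>X\<^esub> c, b \<sqinter>\<^bsub>Y\<^esub> d) \<in> D"
          by (rule product_open_down[OF D ab ac bd X.meet_left[OF c(1,3)] Y.meet_left[OF c(2,4)]])
        moreover have "(a \<sqinter>\<^bsub>X\<^esub> c, b \<sqinter>\<^bsub>Y\<^esub> d) \<in> E"
          by (rule product_open_down[OF E cd ac bd X.meet_right[OF c(1,3)] Y.meet_right[OF c(2,4)]])
        ultimately have "f (a \<sqinter>\<^bsub>X\<^esub> c) \<sqinter>\<^bsub>Z\<^esub> g (b \<sqinter>\<^bsub>Y\<^esub> d) \<sqsubseteq>\<^bsub>Z\<^esub> pairing Z f g (D \<inter> E)"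
          by (intro upper[OF DEo]) blast
        moreover have "f (a \<sqinter>\<^bsub>X\<^esub> c) \<sqinter>\<^bsub>Z\<^esub> g (b \<sqinter>\<^bsub>Y\<^esub> d) = (f a \<sqinter>\<^bsub>Z\<^esub> g b) \<sqinter>\<^bsub>Z\<^esub> (f c \<sqinter>\<^bsub>Z\<^esub> g d)"
        proof -
          note fc' = fc[OF c(1)] fc[OF c(3)] gc[OF c(2)] gc[OF c(4)]
          have "(f a \<sqinter>\<^bsub>Z\<^esub> f c) \<sqinter>\<^bsub>Z\<^esub> (g b \<sqinter>\<^bsub>Z\<^esub> g d) = f a \<sqinter>\<^bsub>Z\<^esub> (f c \<sqinter>\<^bsub>Z\<^esub> (g b \<sqinter>\<^bsub>Z\<^esub> g d))"
            using fc' by (intro Z.meet_assoc) simp_all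
          also have "f c \<sqinter>\<^bsub>Z\<^esub> (g b \<sqinter>\<^bsub>Z\<^esub> g d) = (g b \<sqinter>\<^bsub>Z\<^esub> g d) \<sqinter>\<^bsub>Z\<^esub> f c" by (rule meet_comm)
          also have "\<dots> = g b \<sqinter>\<^bsub>Z\<^esub> (g d \<sqinter>\<^bsub>Z\<^esub> f c)" using fc' by (intro Z.meet_assoc) simp_all
          also have "g d \<sqinter>\<^bsub>Z\<^esub> f c = f c \<sqinter>\<^bsub>Z\<^esub> g d" by (rule meet_comm)
          also have "f a \<sqinter>\<^bsub>Z\<^esub> (g b \<sqinter>\<^bsub>Z\<^esub> (f c \<sqinter>\<^bsub>Z\<^esub> g d)) = (f a \<sqinter>\<^bsub>Z\<^esub> g b) \<sqinter>\<^bsub>Z\<^esub> (f c \<sqinter>\<^bsub>Z\<^esub> g d)"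
            using fc' by (intro Z.meet_assoc[symmetric]) simp_all
          finally show ?thesis unfolding frame_map_meet[OF f c(1,3)] frame_map_meet[OF g c(2,4)] .
        qed
        ultimately show ?thesis by simp
      qed
      have step: "pairing Z f g D \<sqinter>\<^bsub>Z\<^esub> (f c \<sqinter>\<^bsub>Z\<^esub> g d) \<sqsubseteq>\<^bsub>Z\<^esub> pairing Z f g (D \<inter> E)" if cd: "(c, d) \<in> E" for c d
      proof -
        have cdc: "f c \<sqinter>\<^bsub>Z\<^esub> g d \<in> carrier Z" using cd set[OF E] by blast
        have "(f c \<sqinter>\<^bsub>Z\<^esub> g d) \<sqinter>\<^bsub>Z\<^esub> pairing Z f g D \<sqsubseteq>\<^bsub>Z\<^esub> pairing Z f g (D \<inter> E)"
          unfolding pairing_def[of Z f g D] Z.meet_sup_le_iff[OF cdc set[OF D] pc[OF DEo]]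
          using key cd by (auto simp: meet_comm[of Z "f c \<sqinter>\<^bsub>Z\<^esub> g d"])
        then show ?thesis by (simp only: meet_comm)
      qed
      show "pairing Z f g D \<sqinter>\<^bsub>Z\<^esub> pairing Z f g E \<sqsubseteq>\<^bsub>Z\<^esub> pairing Z f g (D \<inter> E)"
        unfolding pairing_def[of Z f g E] Z.meet_sup_le_iff[OF pc[OF D] set[OF E] pc[OF DEo]]
        using step by blast
      show "pairing Z f g D \<sqinter>\<^bsub>Z\<^esub> pairing Z f g E \<in> carrier Z" using pc[OF D] pc[OF E] by simp
    qed (rule pc[OF DEo])
  next
    fix \<D> assume c: "\<D> \<subseteq> carrier (product X Y)"
    then have o: "\<forall>D\<in>\<D>. product_open X Y D" using product_carrier by blast
    note h = product_hull[OF o]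
    have ic: "pairing Z f g ` \<D> \<subseteq> carrier Z" using o pc by blast
    note sc = Z.sup_closed[OF ic]
    show "pairing Z f g (\<Squnion>\<^bsub>product X Y\<^esub>\<D>) = \<Squnion>\<^bsub>Z\<^esub>(pairing Z f g ` \<D>)"
      unfolding product_sup[OF c]
    proof (rule Z.le_antisym)
      have "D \<subseteq> {(a, b) \<in> carrier X \<times> carrier Y. f a \<sqinter>\<^bsub>Z\<^esub> g b \<sqsubseteq>\<^bsub>Z\<^esub> \<Squnion>\<^bsub>Z\<^esub>(pairing Z f g ` \<D>)}"
        if D: "D \<in> \<D>" for D
      proof (rule subrelI)
        fix a b assume ab: "(a, b) \<in> D"
        have Do: "product_open X Y D" using D o by blast
        have abc: "a \<in> carrier X" "b \<in> carrier Y" using product_open_subset[OF Do] ab by blast+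
        have "pairing Z f g D \<sqsubseteq>\<^bsub>Z\<^esub> \<Squnion>\<^bsub>Z\<^esub>(pairing Z f g ` \<D>)" using D by (intro Z.sup_upper[OF ic]) blast
        then have "f a \<sqinter>\<^bsub>Z\<^esub> g b \<sqsubseteq>\<^bsub>Z\<^esub> \<Squnion>\<^bsub>Z\<^esub>(pairing Z f g ` \<D>)"
          by (rule Z.le_trans[OF upper[OF Do ab] _ fg[OF abc] pc[OF Do] sc])
        then show "(a, b) \<in> {(a, b) \<in> carrier X \<times> carrier Y. f a \<sqinter>\<^bsub>Z\<^esub> g b \<sqsubseteq>\<^bsub>Z\<^esub> \<Squnion>\<^bsub>Z\<^esub>(pairing Z f g ` \<D>)}"
          using abc by blast
      qed
      then have "product_hull \<D> \<subseteq> {(a, b) \<in> carrier X \<times> carrier Y. f a \<sqinter>\<^bsub>Z\<^esub> g b \<sqsubseteq>\<^bsub>Z\<^esub> \<Squnion>\<^bsub>Z\<^esub>(pairing Z f g ` \<D>)}"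
        by (intro h(3) fg_open[OF sc]) blast
      then show "pairing Z f g (product_hull \<D>) \<sqsubseteq>\<^bsub>Z\<^esub> \<Squnion>\<^bsub>Z\<^esub>(pairing Z f g ` \<D>)"
        by (intro least[OF h(1) sc]) blast
      show "\<Squnion>\<^bsub>Z\<^esub>(pairing Z f g ` \<D>) \<sqsubseteq>\<^bsub>Z\<^esub> pairing Z f g (product_hull \<D>)"
      proof (rule Z.sup_least[OF ic pc[OF h(1)]])
        fix z assume "z \<in> pairing Z f g ` \<D>"
        then obtain D where D: "D \<in> \<D>" "z = pairing Z f g D" by blast
        have Do: "product_open X Y D" using D o by blast
        show "z \<sqsubseteq>\<^bsub>Z\<^esub> pairing Z f g (product_hull \<D>)"
          unfolding D(2) using upper[OF h(1)] h(2)[OF D(1)] by (intro least[OF Do pc[OF h(1)]]) blast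
      qed
    qed (rule pc[OF h(1)], rule sc)
  qed
  assume h: "locale_map Z (product X Y) h" and hf: "\<forall>U\<in>carrier X. h (pr1 X Y U) = f U"
    and hg: "\<forall>V\<in>carrier Y. h (pr2 X Y V) = g V" and D: "D \<in> carrier (product X Y)"
  have h: "frame_map (product X Y) Z h" using h by (simp add: locale_map_def)
  have Do: "product_open X Y D" using D by (simp add: product_carrier)
  let ?\<R> = "{rectangle X Y a b |a b. (a, b) \<in> D}"
  have ro: "\<forall>E\<in>?\<R>. product_open X Y E"
    using product_open_subset[OF Do] product_open_rectangle by blast
  have rc: "?\<R> \<subseteq> carrier (product X Y)"
  proof
    fix E assume "E \<in> ?\<R>"
    then show "E \<in> carrier (product X Y)" unfolding product_carrier by (rule bspec[OF ro])
  qed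
  have D_eq: "D = \<Squnion>\<^bsub>product X Y\<^esub>?\<R>"
    unfolding product_sup[OF rc]
  proof
    show "D \<subseteq> product_hull ?\<R>"
    proof (rule subrelI)
      fix a b assume ab: "(a, b) \<in> D"
      then have c: "a \<in> carrier X" "b \<in> carrier Y" using product_open_subset[OF Do] by blast+
      have "rectangle X Y a b \<subseteq> product_hull ?\<R>" using ab by (intro product_hull(2)[OF ro]) blast
      then show "(a, b) \<in> product_hull ?\<R>"
        unfolding rectangle_subset_iff[OF c product_hull(1)[OF ro]] .
    qed
    have "rectangle X Y a b \<subseteq> D" if ab: "(a, b) \<in> D" for a b
    proof -
      have c: "a \<in> carrier X" "b \<in> carrier Y" using ab product_open_subset[OF Do] by blast+
      show ?thesis unfolding rectangle_subset_iff[OF c Do] by (rule ab)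
    qed
    then show "product_hull ?\<R> \<subseteq> D" by (intro product_hull(3)[OF ro Do]) blast
  qed
  have hr: "h (rectangle X Y a b) = f a \<sqinter>\<^bsub>Z\<^esub> g b" if a: "a \<in> carrier X" and b: "b \<in> carrier Y" for a b
  proof -
    have c: "pr1 X Y a \<in> carrier (product X Y)" "pr2 X Y b \<in> carrier (product X Y)"
      by (rule frame_map_closed[OF locale_map_pr1[unfolded locale_map_def] a]
          frame_map_closed[OF locale_map_pr2[unfolded locale_map_def] b])+
    have "a \<sqinter>\<^bsub>X\<^esub> \<top>\<^bsub>X\<^esub> = a" "\<top>\<^bsub>Y\<^esub> \<sqinter>\<^bsub>Y\<^esub> b = b"
      using X.le_iff_meet_eq[OF a X.top_closed] Y.le_iff_meet_eq[OF b Y.top_closed] a b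
        meet_comm[of Y b] by simp_all
    then have "rectangle X Y a b = pr1 X Y a \<inter> pr2 X Y b"
      unfolding pr1_def pr2_def using rectangle_Int[OF a X.top_closed Y.top_closed b] by simp
    then have "rectangle X Y a b = pr1 X Y a \<sqinter>\<^bsub>product X Y\<^esub> pr2 X Y b" using product_meet[OF c] by simp
    then show ?thesis using frame_map_meet[OF h c] hf hg a b by simp
  qed
  have "h ` ?\<R> = {f a \<sqinter>\<^bsub>Z\<^esub> g b |a b. (a, b) \<in> D}"
  proof -
    have hD: "h (rectangle X Y a b) = f a \<sqinter>\<^bsub>Z\<^esub> g b" if "(a, b) \<in> D" for a b
      using subsetD[OF product_open_subset[OF Do] that] by (intro hr) (simp_all only: mem_Sigma_iff)
    show ?thesis
    proof (intro subset_antisym subsetI)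
      fix z assume "z \<in> h ` ?\<R>"
      then obtain a b where ab: "(a, b) \<in> D" "z = h (rectangle X Y a b)" by blast
      show "z \<in> {f a \<sqinter>\<^bsub>Z\<^esub> g b |a b. (a, b) \<in> D}"
        unfolding ab(2) hD[OF ab(1)] using ab(1) by blast
    next
      fix z assume "z \<in> {f a \<sqinter>\<^bsub>Z\<^esub> g b |a b. (a, b) \<in> D}"
      then obtain a b where ab: "(a, b) \<in> D" "z = f a \<sqinter>\<^bsub>Z\<^esub> g b" by blast
      show "z \<in> h ` ?\<R>"
        unfolding ab(2) hD[OF ab(1), symmetric] using ab(1) by blast
    qed
  qed
  then show "h D = pairing Z f g D"
    using frame_map_sup[OF h rc] unfolding D_eq[symmetric] pairing_def by simp
qed

end

subsection \<open>Pullbacks\<close>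

lemma pullback:
  fixes A :: "'a gorder" and B :: "'b gorder" and Y :: "'y gorder" and W :: "'w gorder"
  assumes A: "frame A" and B: "frame B" and f: "locale_map A Y f" and g: "locale_map B Y g"
  defines "P \<equiv> pullback A B Y f g"
  shows "is_sublocale (product A B) P"
    and "\<forall>V\<in>carrier Y. snd P (pr1 A B (f V)) = snd P (pr2 A B (g V))"
    and "frame W \<Longrightarrow> locale_map W A h \<Longrightarrow> locale_map W B k \<Longrightarrow> \<forall>V\<in>carrier Y. h (f V) = k (g V) \<Longrightarrow>
          \<exists>l. locale_map W (fst P) l \<and> (\<forall>U\<in>carrier A. l (snd P (pr1 A B U)) = h U) \<and>
              (\<forall>U\<in>carrier B. l (snd P (pr2 A B U)) = k U)"
proof -
  interpret AB: frame_pair A B by (rule frame_pair.intro[OF A B])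
  have lm: "locale_map (product A B) Y (pr1 A B \<circ> f)" "locale_map (product A B) Y (pr2 A B \<circ> g)"
    using frame_map_comp f g AB.locale_map_pr1 AB.locale_map_pr2 unfolding locale_map_def by metis+
  note eq = equaliser[OF AB.product_frame lm, folded pullback_def, folded P_def]
  show "is_sublocale (product A B) P" by (rule eq(1))
  show "\<forall>V\<in>carrier Y. snd P (pr1 A B (f V)) = snd P (pr2 A B (g V))" using eq(2) by simp
  assume W: "frame W" and h: "locale_map W A h" and k: "locale_map W B k"
    and hk: "\<forall>V\<in>carrier Y. h (f V) = k (g V)"
  note u = AB.product_universal[OF W h k]
  have "\<forall>V\<in>carrier Y. pairing W h k ((pr1 A B \<circ> f) V) = pairing W h k ((pr2 A B \<circ> g) V)"
  proof
    fix V assume V: "V \<in> carrier Y"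
    have "f V \<in> carrier A" "g V \<in> carrier B"
      using f g V frame_map_closed unfolding locale_map_def by metis+
    then show "pairing W h k ((pr1 A B \<circ> f) V) = pairing W h k ((pr2 A B \<circ> g) V)"
      using hk V by (simp add: u(2) u(3))
  qed
  then obtain l where l: "locale_map W (fst P) l"
      "\<forall>D\<in>carrier (product A B). l (snd P D) = pairing W h k D"
    using eq(3)[OF W u(1)] by metis
  have "pr1 A B U \<in> carrier (product A B)" if "U \<in> carrier A" for U
    by (rule frame_map_closed[OF AB.locale_map_pr1[unfolded locale_map_def] that])
  moreover have "pr2 A B U \<in> carrier (product A B)" if "U \<in> carrier B" for U
    by (rule frame_map_closed[OF AB.locale_map_pr2[unfolded locale_map_def] that])
  ultimately show "\<exists>l. locale_map W (fst P) l \<and> (\<forall>U\<in>carrier A. l (snd P (pr1 A B U)) = h U) \<and>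
              (\<forall>U\<in>carrier B. l (snd P (pr2 A B U)) = k U)"
    using l u(2,3) by (intro exI[of _ l]) simp
qed

end

theory Submission
  imports Defs
begin

text \<open>
  The opens of 1 are two-valued, so a strongly dense map is one whose inverse image reflects
  \<open>\<bottom>\<close>, and it is enough to show that the inclusion of R into the kernel pair K of q
  is dense.  If \<open>s\<^sup>*U \<sqinter> t\<^sup>*V = \<bottom>\<close>, let \<open>U' = t\<^sub>!(s\<^sup>*U)\<close>.  Then \<open>U \<sqsubseteq> U'\<close> by reflexivity, \<open>U' \<sqinter> V = \<bottom>\<close>
  by Frobenius reciprocity, and \<open>U'\<close> is saturated by Beck--Chevalley, transitivity and symmetry.  A saturated
  open has the same two inverse images in K, so the rectangle \<open>U \<times> V\<close> restricts to an open of K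
  contained in the second inverse image of \<open>U' \<sqinter> V = \<bottom>\<close>.
\<close>

section \<open>Left adjoints of inverse images\<close>

lemma (in frame) meet_mono:
  assumes "x \<in> carrier L" "y \<in> carrier L" "x' \<in> carrier L" "y' \<in> carrier L" "x \<sqsubseteq> x'" "y \<sqsubseteq> y'"
  shows "x \<sqinter> y \<sqsubseteq> x' \<sqinter> y'"
proof (rule meet_le)
  show "x \<sqinter> y \<sqsubseteq> x'" by (rule le_trans[OF meet_left]) (use assms in simp_all)
  show "x \<sqinter> y \<sqsubseteq> y'" by (rule le_trans[OF meet_right]) (use assms in simp_all)
qed (use assms in simp_all)

lemma left_adjoint_mono:
  assumes X: "frame X" and Y: "frame Y" and f: "locale_map X Y f"
    and e: "e \<in> carrier X \<rightarrow> carrier Y"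
    and adj: "\<forall>U\<in>carrier X. \<forall>V\<in>carrier Y. e U \<sqsubseteq>\<^bsub>Y\<^esub> V \<longleftrightarrow> U \<sqsubseteq>\<^bsub>X\<^esub> f V"
    and U: "U \<in> carrier X" "U' \<in> carrier X" "U \<sqsubseteq>\<^bsub>X\<^esub> U'"
  shows "e U \<sqsubseteq>\<^bsub>Y\<^esub> e U'"
proof -
  interpret X: frame X by fact
  interpret Y: frame Y by fact
  have ec: "e U' \<in> carrier Y" using e U by auto
  have "f (e U') \<in> carrier X" using f ec by (auto simp: locale_map_def frame_map_closed)
  moreover have "U' \<sqsubseteq>\<^bsub>X\<^esub> f (e U')" using adj U ec Y.le_refl[OF ec] by blast
  ultimately have "U \<sqsubseteq>\<^bsub>X\<^esub> f (e U')" using U X.le_trans by blast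
  then show ?thesis using adj U ec by blast
qed

text \<open>Needed for arbitrary families, to close the set \<open>D\<close> of the next proof under
  joins in the first coordinate, and for the empty family, where it makes \<open>e\<close> preserve
  bottom.\<close>

lemma left_adjoint_sup:
  assumes X: "frame X" and Y: "frame Y" and f: "locale_map X Y f"
    and e: "e \<in> carrier X \<rightarrow> carrier Y"
    and adj: "\<forall>U\<in>carrier X. \<forall>V\<in>carrier Y. e U \<sqsubseteq>\<^bsub>Y\<^esub> V \<longleftrightarrow> U \<sqsubseteq>\<^bsub>X\<^esub> f V"
    and A: "A \<subseteq> carrier X"
  shows "e (\<Squnion>\<^bsub>X\<^esub>A) = \<Squnion>\<^bsub>Y\<^esub>(e ` A)"
proof -
  interpret X: frame X by fact
  interpret Y: frame Y by fact
  have sA: "\<Squnion>\<^bsub>X\<^esub>A \<in> carrier X" by (rule X.sup_closed[OF A])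
  have ec: "e ` A \<subseteq> carrier Y" using e A by auto
  show ?thesis
  proof (rule Y.sup_eqI[symmetric, OF ec])
    show "e (\<Squnion>\<^bsub>X\<^esub>A) \<in> carrier Y" using e sA by auto
    show "y \<sqsubseteq>\<^bsub>Y\<^esub> e (\<Squnion>\<^bsub>X\<^esub>A)" if y: "y \<in> e ` A" for y
    proof -
      obtain a where a: "a \<in> A" "y = e a" using y by blast
      have ac: "a \<in> carrier X" using a(1) A by blast
      show ?thesis
        unfolding a(2) by (rule left_adjoint_mono[OF X Y f e adj ac sA X.sup_upper[OF A a(1)]])
    qed
    fix z assume z: "z \<in> carrier Y" and ub: "\<And>y. y \<in> e ` A \<Longrightarrow> y \<sqsubseteq>\<^bsub>Y\<^esub> z"
    have fz: "f z \<in> carrier X" using f z by (auto simp: locale_map_def frame_map_closed)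
    have "\<Squnion>\<^bsub>X\<^esub>A \<sqsubseteq>\<^bsub>X\<^esub> f z"
    proof (rule X.sup_least[OF A fz])
      fix a assume a: "a \<in> A"
      have "e a \<sqsubseteq>\<^bsub>Y\<^esub> z" using ub a by blast
      then show "a \<sqsubseteq>\<^bsub>X\<^esub> f z" using adj a A z by blast
    qed
    then show "e (\<Squnion>\<^bsub>X\<^esub>A) \<sqsubseteq>\<^bsub>Y\<^esub> z" using adj sA z by blast
  qed
qed

section \<open>Beck-Chevalley for an open map\<close>

text \<open>
  The set D in the proof describes \<open>\<pi>\<^sub>2\<^sup>*Z\<close> without reference to the closure operator of the
  pullback; that it is an open of the pullback is where openness of f enters.
\<close>

lemma pullback_open_beck_chevalley:
  fixes A :: "'a gorder" and B :: "'b gorder" and Y :: "'y gorder"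
  assumes A: "frame A" and B: "frame B" and Y: "frame Y"
    and f: "locale_map A Y f" and g: "locale_map B Y g"
    and e: "e \<in> carrier A \<rightarrow> carrier Y"
    and adj: "\<forall>U\<in>carrier A. \<forall>V\<in>carrier Y. e U \<sqsubseteq>\<^bsub>Y\<^esub> V \<longleftrightarrow> U \<sqsubseteq>\<^bsub>A\<^esub> f V"
    and frob: "\<forall>U\<in>carrier A. \<forall>V\<in>carrier Y. e (U \<sqinter>\<^bsub>A\<^esub> f V) = e U \<sqinter>\<^bsub>Y\<^esub> V"
    and W: "W \<in> carrier A" and Z: "Z \<in> carrier B"
    and le: "snd (pullback A B Y f g) (pr1 A B W) \<sqsubseteq>\<^bsub>fst (pullback A B Y f g)\<^esub>
             snd (pullback A B Y f g) (pr2 A B Z)"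
  shows "g (e W) \<sqsubseteq>\<^bsub>B\<^esub> Z"
proof -
  interpret AB: frame_pair A B by (rule frame_pair.intro[OF A B])
  interpret Y: frame Y by fact
  interpret P: frame "product A B" by (rule AB.product_frame)
  have ff: "frame_map Y A f" and gf: "frame_map Y B g" using f g by (simp_all add: locale_map_def)
  note fc = frame_map_closed[OF ff] and gc = frame_map_closed[OF gf]
  have ec: "e a \<in> carrier Y" if "a \<in> carrier A" for a using e that by auto
  have gec: "g (e a) \<in> carrier B" if "a \<in> carrier A" for a using gc[OF ec[OF that]] .
  have ge_mono: "g (e a) \<sqsubseteq>\<^bsub>B\<^esub> g (e a')" if "a \<in> carrier A" "a' \<in> carrier A" "a \<sqsubseteq>\<^bsub>A\<^esub> a'" for a a'
    by (rule frame_map_mono[OF Y B gf ec[OF that(1)] ec[OF that(2)] left_adjoint_mono[OF A Y f e adj that]])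
  \<comment> \<open>Beck-Chevalley and Frobenius predict that the restriction of the rectangle
    \<open>a x b\<close> to the pullback has image \<open>b\<close> met with \<open>g (e a)\<close>
    under the second projection. Membership in \<open>D\<close> says that this expected image lies
    in \<open>Z\<close>.\<close>
  define D where "D = {(a, b) \<in> carrier A \<times> carrier B. b \<sqinter>\<^bsub>B\<^esub> g (e a) \<sqsubseteq>\<^bsub>B\<^esub> Z}"
  have D_iff: "(a, b) \<in> D \<longleftrightarrow> a \<in> carrier A \<and> b \<in> carrier B \<and> b \<sqinter>\<^bsub>B\<^esub> g (e a) \<sqsubseteq>\<^bsub>B\<^esub> Z" for a b
    by (auto simp: D_def)
  have Do: "product_open A B D"
  proof (rule AB.product_openI)
    show "D \<subseteq> carrier A \<times> carrier B" by (auto simp: D_def)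
  next
    fix a b a' b'
    assume ab: "(a, b) \<in> D" and c: "a \<in> carrier A" "b \<in> carrier B" "a' \<in> carrier A" "b' \<in> carrier B"
      and le: "a' \<sqsubseteq>\<^bsub>A\<^esub> a" "b' \<sqsubseteq>\<^bsub>B\<^esub> b"
    have "b' \<sqinter>\<^bsub>B\<^esub> g (e a') \<sqsubseteq>\<^bsub>B\<^esub> b \<sqinter>\<^bsub>B\<^esub> g (e a)"
      by (rule AB.Y.meet_mono[OF c(4) gec[OF c(3)] c(2) gec[OF c(1)] le(2) ge_mono[OF c(3,1) le(1)]])
    moreover have "b \<sqinter>\<^bsub>B\<^esub> g (e a) \<sqsubseteq>\<^bsub>B\<^esub> Z" using ab D_iff by simp
    ultimately have "b' \<sqinter>\<^bsub>B\<^esub> g (e a') \<sqsubseteq>\<^bsub>B\<^esub> Z"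
      by (rule AB.Y.le_trans) (use c gec Z in simp_all)
    then show "(a', b') \<in> D" using c D_iff by simp
  next
    fix K b assume K: "K \<subseteq> carrier A" and b: "b \<in> carrier B" and m: "\<forall>a\<in>K. (a, b) \<in> D"
    have eK: "e ` K \<subseteq> carrier Y" using K ec by blast
    have gK: "g ` e ` K \<subseteq> carrier B" using eK gc by blast
    have "g (e (\<Squnion>\<^bsub>A\<^esub>K)) = \<Squnion>\<^bsub>B\<^esub>(g ` e ` K)"
      using left_adjoint_sup[OF A Y f e adj K] frame_map_sup[OF gf eK] by simp
    then have "b \<sqinter>\<^bsub>B\<^esub> g (e (\<Squnion>\<^bsub>A\<^esub>K)) \<sqsubseteq>\<^bsub>B\<^esub> Z"
      using AB.Y.meet_sup_le_iff[OF b gK Z] m D_iff by simp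
    then show "(\<Squnion>\<^bsub>A\<^esub>K, b) \<in> D" using AB.X.sup_closed[OF K] b D_iff by simp
  next
    fix a K assume a: "a \<in> carrier A" and K: "K \<subseteq> carrier B" and m: "\<forall>b\<in>K. (a, b) \<in> D"
    have "g (e a) \<sqinter>\<^bsub>B\<^esub> \<Squnion>\<^bsub>B\<^esub>K \<sqsubseteq>\<^bsub>B\<^esub> Z"
      using AB.Y.meet_sup_le_iff[OF gec[OF a] K Z] m D_iff by (simp add: meet_comm[of B "g (e a)"])
    then show "(a, \<Squnion>\<^bsub>B\<^esub>K) \<in> D"
      using AB.Y.sup_closed[OF K] a D_iff by (simp add: meet_comm[of B "g (e a)"])
  qed
  \<comment> \<open>A rectangle contains every pair with a bottom coordinate, so each unfolding of
    \<open>rectangle\<close> leaves these degenerate pairs as extra cases.\<close>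
  have bot: "(a, b) \<in> D" if "a \<in> carrier A" "b \<in> carrier B" "a = \<bottom>\<^bsub>A\<^esub> \<or> b = \<bottom>\<^bsub>B\<^esub>" for a b
    using AB.product_open_bottom[OF Do] that by auto
  have pc1: "pr1 A B U \<in> carrier (product A B)" if "U \<in> carrier A" for U
    by (rule frame_map_closed[OF AB.locale_map_pr1[unfolded locale_map_def] that])
  have pc2: "pr2 A B V \<in> carrier (product A B)" if "V \<in> carrier B" for V
    by (rule frame_map_closed[OF AB.locale_map_pr2[unfolded locale_map_def] that])
  let ?S = "equaliser_opens (product A B) Y (pr1 A B \<circ> f) (pr2 A B \<circ> g)"
  have DS: "D \<in> ?S"
    unfolding equaliser_opens_def
  proof (intro CollectI conjI ballI)
    show "D \<in> carrier (product A B)" using Do by (simp add: AB.product_carrier)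
  next
    fix V w assume V: "V \<in> carrier Y" and w: "w \<in> carrier (product A B)"
    have wo: "product_open A B w" using w by (simp add: AB.product_carrier)
    note fV = fc[OF V] and gV = gc[OF V]
    have "w \<inter> pr1 A B (f V) \<subseteq> D \<longleftrightarrow> w \<inter> pr2 A B (g V) \<subseteq> D"
    proof
      \<comment> \<open>Shrinking \<open>a\<close> to its meet with \<open>f V\<close> gives a pair
        covered by the assumption. Frobenius turns \<open>e\<close> of that meet into the meet of
        \<open>e a\<close> and \<open>V\<close>, and the resulting factor \<open>g V\<close> is
        absorbed by \<open>b\<close>.\<close>
      assume l: "w \<inter> pr1 A B (f V) \<subseteq> D"
      show "w \<inter> pr2 A B (g V) \<subseteq> D"
      proof (rule subrelI)
        fix a b assume "(a, b) \<in> w \<inter> pr2 A B (g V)"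
        then have ab: "(a, b) \<in> w" "a \<in> carrier A" "b \<in> carrier B"
          and c: "b \<sqsubseteq>\<^bsub>B\<^esub> g V \<or> a = \<bottom>\<^bsub>A\<^esub> \<or> b = \<bottom>\<^bsub>B\<^esub>"
          unfolding pr2_def by (auto simp: AB.rectangle_iff)
        show "(a, b) \<in> D"
        proof (cases "b \<sqsubseteq>\<^bsub>B\<^esub> g V")
          case True
          have m: "a \<sqinter>\<^bsub>A\<^esub> f V \<in> carrier A" "a \<sqinter>\<^bsub>A\<^esub> f V \<sqsubseteq>\<^bsub>A\<^esub> a" "a \<sqinter>\<^bsub>A\<^esub> f V \<sqsubseteq>\<^bsub>A\<^esub> f V"
            using ab(2) fV by (simp_all add: AB.X.meet_left AB.X.meet_right)
          have "(a \<sqinter>\<^bsub>A\<^esub> f V, b) \<in> w"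
            by (rule AB.product_open_down[OF wo ab(1) m(1) ab(3) m(2) AB.Y.le_refl[OF ab(3)]])
          moreover have "(a \<sqinter>\<^bsub>A\<^esub> f V, b) \<in> pr1 A B (f V)"
            unfolding pr1_def AB.rectangle_iff using m ab AB.Y.top_higher by blast
          ultimately have "(a \<sqinter>\<^bsub>A\<^esub> f V, b) \<in> D" using l by blast
          then have "b \<sqinter>\<^bsub>B\<^esub> g (e (a \<sqinter>\<^bsub>A\<^esub> f V)) \<sqsubseteq>\<^bsub>B\<^esub> Z" using D_iff by simp
          moreover have "g (e (a \<sqinter>\<^bsub>A\<^esub> f V)) = g (e a) \<sqinter>\<^bsub>B\<^esub> g V"
            using frob ab(2) V frame_map_meet[OF gf ec[OF ab(2)] V] by simp
          moreover have "b \<sqinter>\<^bsub>B\<^esub> (g (e a) \<sqinter>\<^bsub>B\<^esub> g V) = b \<sqinter>\<^bsub>B\<^esub> g (e a)"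
          proof -
            have "b \<sqinter>\<^bsub>B\<^esub> (g (e a) \<sqinter>\<^bsub>B\<^esub> g V) = b \<sqinter>\<^bsub>B\<^esub> (g V \<sqinter>\<^bsub>B\<^esub> g (e a))"
              by (simp only: meet_comm[of B "g V"])
            also have "\<dots> = (b \<sqinter>\<^bsub>B\<^esub> g V) \<sqinter>\<^bsub>B\<^esub> g (e a)"
              by (rule AB.Y.meet_assoc[symmetric, OF ab(3) gV gec[OF ab(2)]])
            also have "b \<sqinter>\<^bsub>B\<^esub> g V = b" using AB.Y.le_iff_meet_eq[OF ab(3) gV] True by simp
            finally show ?thesis .
          qed
          ultimately show ?thesis using D_iff ab by simp
        qed (use bot ab c in blast)
      qed
    next
      \<comment> \<open>Now \<open>b\<close> is shrunk to its meet with \<open>g V\<close>. This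
        costs nothing: if \<open>a\<close> lies below \<open>f V\<close>, then \<open>e a\<close>
        lies below \<open>V\<close> by adjunction, so \<open>g (e a)\<close> absorbs the factor
        \<open>g V\<close>.\<close>
      assume l: "w \<inter> pr2 A B (g V) \<subseteq> D"
      show "w \<inter> pr1 A B (f V) \<subseteq> D"
      proof (rule subrelI)
        fix a b assume "(a, b) \<in> w \<inter> pr1 A B (f V)"
        then have ab: "(a, b) \<in> w" "a \<in> carrier A" "b \<in> carrier B"
          and c: "a \<sqsubseteq>\<^bsub>A\<^esub> f V \<or> a = \<bottom>\<^bsub>A\<^esub> \<or> b = \<bottom>\<^bsub>B\<^esub>"
          unfolding pr1_def by (auto simp: AB.rectangle_iff)
        show "(a, b) \<in> D"
        proof (cases "a \<sqsubseteq>\<^bsub>A\<^esub> f V")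
          case True
          have m: "b \<sqinter>\<^bsub>B\<^esub> g V \<in> carrier B" "b \<sqinter>\<^bsub>B\<^esub> g V \<sqsubseteq>\<^bsub>B\<^esub> b" "b \<sqinter>\<^bsub>B\<^esub> g V \<sqsubseteq>\<^bsub>B\<^esub> g V"
            using ab(3) gV by (simp_all add: AB.Y.meet_left AB.Y.meet_right)
          have "(a, b \<sqinter>\<^bsub>B\<^esub> g V) \<in> w"
            by (rule AB.product_open_down[OF wo ab(1) ab(2) m(1) AB.X.le_refl[OF ab(2)] m(2)])
          moreover have "(a, b \<sqinter>\<^bsub>B\<^esub> g V) \<in> pr2 A B (g V)"
            unfolding pr2_def AB.rectangle_iff using m ab AB.X.top_higher by blast
          ultimately have "(a, b \<sqinter>\<^bsub>B\<^esub> g V) \<in> D" using l by blast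
          then have "(b \<sqinter>\<^bsub>B\<^esub> g V) \<sqinter>\<^bsub>B\<^esub> g (e a) \<sqsubseteq>\<^bsub>B\<^esub> Z" using D_iff by simp
          moreover have "(b \<sqinter>\<^bsub>B\<^esub> g V) \<sqinter>\<^bsub>B\<^esub> g (e a) = b \<sqinter>\<^bsub>B\<^esub> g (e a)"
          proof -
            have "e a \<sqsubseteq>\<^bsub>Y\<^esub> V" using adj ab(2) V True by blast
            then have "g (e a) \<sqsubseteq>\<^bsub>B\<^esub> g V" by (rule frame_map_mono[OF Y B gf ec[OF ab(2)] V])
            then have "g (e a) \<sqinter>\<^bsub>B\<^esub> g V = g (e a)"
              using AB.Y.le_iff_meet_eq[OF gec[OF ab(2)] gV] by simp
            then show ?thesis
              using AB.Y.meet_assoc[OF ab(3) gV gec[OF ab(2)]] by (simp add: meet_comm[of B "g V"])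
          qed
          ultimately show ?thesis using D_iff ab by simp
        qed (use bot ab c in blast)
      qed
    qed
    then show "w \<sqinter>\<^bsub>product A B\<^esub> (pr1 A B \<circ> f) V \<sqsubseteq>\<^bsub>product A B\<^esub> D \<longleftrightarrow>
        w \<sqinter>\<^bsub>product A B\<^esub> (pr2 A B \<circ> g) V \<sqsubseteq>\<^bsub>product A B\<^esub> D"
      by (simp add: AB.product_meet[OF w pc1[OF fV]] AB.product_meet[OF w pc2[OF gV]] AB.product_le)
  qed
  \<comment> \<open>\<open>?j\<close> is the closure operator of the pullback. Since
    \<open>D\<close> is closed and contains \<open>pr2 A B Z\<close>, the hypothesis
    \<open>le\<close> gives a chain of inclusions from \<open>pr1 A B W\<close> through its closure
    and that of \<open>pr2 A B Z\<close> into \<open>D\<close>. The claim is this chain evaluated at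
    the pair of \<open>W\<close> and top.\<close>
  let ?j = "\<lambda>z. \<Sqinter>\<^bsub>product A B\<^esub>{s \<in> ?S. z \<sqsubseteq>\<^bsub>product A B\<^esub> s}"
  have Sc: "{s \<in> ?S. z \<sqsubseteq>\<^bsub>product A B\<^esub> s} \<subseteq> carrier (product A B)" for z
    by (auto simp: equaliser_opens_def)
  have "b \<sqinter>\<^bsub>B\<^esub> g (e a) \<sqsubseteq>\<^bsub>B\<^esub> Z" if "a \<in> carrier A" "b \<in> carrier B" "b \<sqsubseteq>\<^bsub>B\<^esub> Z" for a b
    by (rule AB.Y.le_trans[OF AB.Y.meet_left]) (use that gec Z in simp_all)
  then have "pr2 A B Z \<subseteq> D"
    using bot by (auto simp: pr2_def AB.rectangle_iff D_iff)
  then have "?j (pr2 A B Z) \<subseteq> D"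
    using P.inf_lower[OF Sc, of D "pr2 A B Z"] DS by (simp add: AB.product_le)
  moreover have "?j (pr1 A B W) \<subseteq> ?j (pr2 A B Z)"
    using le by (simp add: pullback_def equaliser_def AB.product_le)
  moreover have "pr1 A B W \<subseteq> ?j (pr1 A B W)"
    using P.inf_greatest[OF Sc pc1[OF W], of "pr1 A B W"] by (simp add: AB.product_le)
  moreover have "(W, \<top>\<^bsub>B\<^esub>) \<in> pr1 A B W"
    unfolding pr1_def AB.rectangle_iff using W by simp
  ultimately have "(W, \<top>\<^bsub>B\<^esub>) \<in> D" by blast
  then have "\<top>\<^bsub>B\<^esub> \<sqinter>\<^bsub>B\<^esub> g (e W) \<sqsubseteq>\<^bsub>B\<^esub> Z" using D_iff by simp
  moreover have "\<top>\<^bsub>B\<^esub> \<sqinter>\<^bsub>B\<^esub> g (e W) = g (e W)"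
    using AB.Y.le_iff_meet_eq[OF gec[OF W] AB.Y.top_closed] AB.Y.top_higher[OF gec[OF W]]
    by (simp add: meet_comm[of B "g (e W)"])
  ultimately show ?thesis by simp
qed

section \<open>The equivalence relation in terms of its source and target\<close>

locale open_equivalence = X: frame X for X :: "'x gorder" +
  fixes R :: "('x, 'r) locrel"
  assumes equivalence: "localic_equivalence X R" and cones: "open_cones X R"
begin

sublocale XX: frame_pair X X by unfold_locales

sublocale R: frame "fst R"
  using equivalence by (simp add: localic_equivalence_def localic_relation_def is_sublocale_def)

lemma snd_frame_map: "frame_map (product X X) (fst R) (snd R)"
  using equivalence
  by (simp add: localic_equivalence_def localic_relation_def is_sublocale_def locale_map_def)

lemma source_locale_map: "locale_map (fst R) X (rel_source X R)"
  and target_locale_map: "locale_map (fst R) X (rel_target X R)"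
  using cones by (simp_all add: open_cones_def open_locale_map_def)

lemmas source_frame_map = source_locale_map[unfolded locale_map_def]
  and target_frame_map = target_locale_map[unfolded locale_map_def]

lemma pr_closed: "U \<in> carrier X \<Longrightarrow> pr1 X X U \<in> carrier (product X X)"
    "U \<in> carrier X \<Longrightarrow> pr2 X X U \<in> carrier (product X X)"
  by (rule frame_map_closed[OF XX.locale_map_pr1[unfolded locale_map_def]]
      frame_map_closed[OF XX.locale_map_pr2[unfolded locale_map_def]]; assumption)+

text \<open>The inclusion of the diagonal becomes a common section of source and target, because the
  diagonal followed by either projection is the identity.\<close>

lemma reflexive:
  obtains d where "frame_map (fst R) X d"
    "\<And>U. U \<in> carrier X \<Longrightarrow> d (rel_source X R U) = U" "\<And>U. U \<in> carrier X \<Longrightarrow> d (rel_target X R U) = U"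
proof -
  have id: "locale_map X X (\<lambda>U. U)" by (simp add: locale_map_def frame_map_def)
  obtain d where d: "sub_inclusion (product X X) (diagonal X) R d"
    using equivalence unfolding localic_equivalence_def sub_le_def by blast
  show ?thesis
  proof
    show "frame_map (fst R) X d" using d by (simp add: sub_inclusion_def locale_map_def diagonal_def)
    show "d (rel_source X R U) = U" "d (rel_target X R U) = U" if U: "U \<in> carrier X" for U
      using d pr_closed[OF U] XX.product_universal(2,3)[OF XX.X id id U]
      by (simp_all add: sub_inclusion_def diagonal_def rel_source_def rel_target_def)
  qed
qed

text \<open>The comparison of \<open>R\<close> with \<open>rel_op X R\<close> becomes an
  endomorphism of \<open>R\<close> exchanging source and target. It serves to reverse an inequality
  between the two inverse images of an open.\<close>

lemma symmetric:
  obtains i where "frame_map (fst R) (fst R) i"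
    "\<And>U. U \<in> carrier X \<Longrightarrow> i (rel_source X R U) = rel_target X R U"
    "\<And>U. U \<in> carrier X \<Longrightarrow> i (rel_target X R U) = rel_source X R U"
proof -
  obtain i where i: "sub_inclusion (product X X) R (rel_op X R) i"
    using equivalence unfolding localic_equivalence_def sub_eq_def by blast
  show ?thesis
  proof
    show "frame_map (fst R) (fst R) i" using i by (simp add: sub_inclusion_def locale_map_def rel_op_def)
    show "i (rel_source X R U) = rel_target X R U" "i (rel_target X R U) = rel_source X R U"
      if U: "U \<in> carrier X" for U
    proof -
      note u = XX.product_universal(2,3)[OF R.frame_axioms target_locale_map source_locale_map U]
      have "i (pairing (fst R) (rel_target X R) (rel_source X R) D) = snd R D"
        if "D \<in> carrier (product X X)" for D
        using i that by (simp add: sub_inclusion_def rel_op_def)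
      from this[OF pr_closed(1)[OF U]] this[OF pr_closed(2)[OF U]]
      show "i (rel_source X R U) = rel_target X R U" "i (rel_target X R U) = rel_source X R U"
        unfolding u by (simp_all add: rel_source_def rel_target_def)
    qed
  qed
qed

text \<open>The map from the pullback through the composite relation into \<open>R\<close> has as
  source and target the outer legs of a composable pair, so its inverse image carries an inequality
  in \<open>R\<close> to one between these legs.\<close>

lemma transitive:
  assumes U: "U \<in> carrier X" and V: "V \<in> carrier X"
    and le: "rel_source X R U \<sqsubseteq>\<^bsub>fst R\<^esub> rel_target X R V"
  defines "P \<equiv> pullback (fst R) (fst R) X (rel_target X R) (rel_source X R)"
  shows "snd P (pr1 (fst R) (fst R) (rel_source X R U)) \<sqsubseteq>\<^bsub>fst P\<^esub>
         snd P (pr2 (fst R) (fst R) (rel_target X R V))"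
proof -
  interpret RR: frame_pair "fst R" "fst R" by unfold_locales
  have subP: "is_sublocale (product (fst R) (fst R)) P"
    unfolding P_def
    by (rule pullback(1)[OF R.frame_axioms R.frame_axioms target_locale_map source_locale_map])
  interpret P: frame "fst P" using subP by (simp add: is_sublocale_def)
  let ?p1 = "snd P \<circ> pr1 (fst R) (fst R)" and ?p2 = "snd P \<circ> pr2 (fst R) (fst R)"
  let ?f = "?p1 \<circ> rel_source X R" and ?g = "?p2 \<circ> rel_target X R"
  have sndP: "frame_map (product (fst R) (fst R)) (fst P) (snd P)"
    using subP by (simp add: is_sublocale_def locale_map_def)
  have f: "locale_map (fst P) X ?f" and g: "locale_map (fst P) X ?g"
    unfolding locale_map_def
    by (intro frame_map_comp[OF source_frame_map] frame_map_comp[OF target_frame_map] frame_map_comp[OF _ sndP]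
        RR.locale_map_pr1[unfolded locale_map_def] RR.locale_map_pr2[unfolded locale_map_def])+
  note u = XX.product_universal[OF P.frame_axioms f g]
  let ?I = "image_sub (product X X) (fst P) (pairing (fst P) ?f ?g)"
  have comp: "rel_comp X R = ?I" by (simp add: rel_comp_def Let_def P_def)
  have I: "is_sublocale (product X X) ?I"
    by (rule image_sub(1)[OF XX.product_frame P.frame_axioms u(1)])
  obtain m where m: "sub_inclusion (product X X) ?I R m"
    using equivalence unfolding localic_equivalence_def comp sub_le_def by blast
  have mf: "frame_map (fst R) (fst ?I) m" using m by (simp add: sub_inclusion_def locale_map_def)
  have fI: "frame (fst ?I)" using I by (simp add: is_sublocale_def)
  have "m (rel_source X R U) \<sqsubseteq>\<^bsub>fst ?I\<^esub> m (rel_target X R V)"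
    by (rule frame_map_mono[OF R.frame_axioms fI mf _ _ le])
      (rule frame_map_closed[OF source_frame_map U] frame_map_closed[OF target_frame_map V])+
  moreover have "m (rel_source X R U) = ?f U"
    using m pr_closed(1)[OF U] u(2)[OF U] by (simp add: sub_inclusion_def image_sub_def rel_source_def)
  moreover have "m (rel_target X R V) = ?g V"
    using m pr_closed(2)[OF V] u(3)[OF V] by (simp add: sub_inclusion_def image_sub_def rel_target_def)
  \<comment> \<open>The opens of the image form a subset of the opens of \<open>P\<close> with the
    same order, so an inequality in \<open>?I\<close> is one in \<open>P\<close>.\<close>
  ultimately show ?thesis by (simp add: image_sub_def)
qed

section \<open>Saturation of an open under the relation\<close>

lemma saturation:
  assumes U: "U \<in> carrier X"
  obtains U' where "U' \<in> carrier X" "U \<sqsubseteq>\<^bsub>X\<^esub> U'" "rel_source X R U' = rel_target X R U'"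
    "\<And>V. V \<in> carrier X \<Longrightarrow> rel_source X R U \<sqinter>\<^bsub>fst R\<^esub> rel_target X R V = \<bottom>\<^bsub>fst R\<^esub> \<Longrightarrow> U' \<sqinter>\<^bsub>X\<^esub> V = \<bottom>\<^bsub>X\<^esub>"
proof -
  let ?s = "rel_source X R" and ?t = "rel_target X R"
  note sc = frame_map_closed[OF source_frame_map] and tc = frame_map_closed[OF target_frame_map]
  obtain e where e: "e \<in> carrier (fst R) \<rightarrow> carrier X"
    and adj: "\<forall>U\<in>carrier (fst R). \<forall>V\<in>carrier X. e U \<sqsubseteq>\<^bsub>X\<^esub> V \<longleftrightarrow> U \<sqsubseteq>\<^bsub>fst R\<^esub> ?t V"
    and frob: "\<forall>U\<in>carrier (fst R). \<forall>V\<in>carrier X. e (U \<sqinter>\<^bsub>fst R\<^esub> ?t V) = e U \<sqinter>\<^bsub>X\<^esub> V"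
    using cones unfolding open_cones_def open_locale_map_def by blast
  define U' where "U' = e (?s U)"
  have U': "U' \<in> carrier X" unfolding U'_def using e sc[OF U] by auto
  \<comment> \<open>The unit of the adjunction between \<open>e\<close> and the target. It is used
    twice: pulled back along the diagonal it gives that \<open>U\<close> lies below
    \<open>U'\<close>, and through transitivity it gives saturation.\<close>
  have unit: "?s U \<sqsubseteq>\<^bsub>fst R\<^esub> ?t U'"
    using adj sc[OF U] U' X.le_refl[OF U'] unfolding U'_def by blast
  \<comment> \<open>Transitivity carries \<open>unit\<close> to the pullback of target and source.
    Beck-Chevalley, with the target as the open map \<open>f\<close> and the source as
    \<open>g\<close>, then bounds the source inverse image of \<open>e (?s U)\<close>, which is
    \<open>U'\<close>.\<close>
  have le: "?s U' \<sqsubseteq>\<^bsub>fst R\<^esub> ?t U'"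
    unfolding U'_def
    by (rule pullback_open_beck_chevalley[OF R.frame_axioms R.frame_axioms XX.X target_locale_map
          source_locale_map e adj frob sc[OF U] tc[OF U'[unfolded U'_def]]
          transitive[OF U U'[unfolded U'_def] unit[unfolded U'_def]]])
  obtain i where i: "frame_map (fst R) (fst R) i" "i (?s U') = ?t U'" "i (?t U') = ?s U'"
    using symmetric U' by metis
  \<comment> \<open>Applying \<open>i\<close> to \<open>le\<close> swaps its two sides.\<close>
  have ge: "?t U' \<sqsubseteq>\<^bsub>fst R\<^esub> ?s U'"
    using frame_map_mono[OF R.frame_axioms R.frame_axioms i(1) sc[OF U'] tc[OF U'] le] i by simp
  obtain d where d: "frame_map (fst R) X d" "d (?s U) = U" "d (?t U') = U'"
    using reflexive U U' by metis
  show ?thesis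
  proof
    show "U' \<in> carrier X" by (rule U')
    show "U \<sqsubseteq>\<^bsub>X\<^esub> U'"
      using frame_map_mono[OF R.frame_axioms XX.X d(1) sc[OF U] tc[OF U'] unit] d by simp
    show "?s U' = ?t U'" by (rule R.le_antisym[OF le ge sc[OF U'] tc[OF U']])
    fix V assume V: "V \<in> carrier X" and dis: "?s U \<sqinter>\<^bsub>fst R\<^esub> ?t V = \<bottom>\<^bsub>fst R\<^esub>"
    \<comment> \<open>Frobenius rewrites the meet of \<open>U'\<close> and \<open>V\<close> as
      \<open>e\<close> of a disjoint meet, so it remains that \<open>e\<close> preserves
      bottom.\<close>
    have "e \<bottom>\<^bsub>fst R\<^esub> = \<bottom>\<^bsub>X\<^esub>"
      using left_adjoint_sup[OF R.frame_axioms XX.X target_locale_map e adj, of "{}"]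
      by (simp add: X.sup_empty_eq R.sup_empty_eq)
    then show "U' \<sqinter>\<^bsub>X\<^esub> V = \<bottom>\<^bsub>X\<^esub>" using frob sc[OF U] V dis unfolding U'_def by metis
  qed
qed

section \<open>The kernel pair and its comparison with the relation\<close>

abbreviation "K \<equiv> kernel_pair X (quotient_locale X R) (quotient_map X R)"

lemma quotient_locale_map: "locale_map X (quotient_locale X R) (quotient_map X R)"
  unfolding quotient_locale_def quotient_map_def
  by (rule coequaliser(2)[OF XX.X R.frame_axioms source_locale_map target_locale_map])

lemmas kernel_pair_pullback =
  pullback[OF XX.X XX.X quotient_locale_map quotient_locale_map, folded kernel_pair_def]

text \<open>Such \<open>U\<close> are exactly the opens of the quotient, and the inverse image of
  the quotient map is the identity on them, so this is the commuting square of the kernel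
  pair.\<close>

lemma kernel_pair_eq:
  assumes "U \<in> carrier X" "rel_source X R U = rel_target X R U"
  shows "snd K (pr1 X X U) = snd K (pr2 X X U)"
  using kernel_pair_pullback(2) assms
  by (simp add: quotient_locale_def quotient_map_def coequaliser_def)

lemma kernel_pair_inclusion:
  obtains l where "sub_inclusion (product X X) R K l"
proof -
  have sndK: "frame_map (product X X) (fst K) (snd K)"
    using kernel_pair_pullback(1) by (simp add: is_sublocale_def locale_map_def)
  have "\<forall>V\<in>carrier (quotient_locale X R).
      rel_source X R (quotient_map X R V) = rel_target X R (quotient_map X R V)"
    unfolding quotient_locale_def quotient_map_def
    by (rule coequaliser(3)[OF XX.X R.frame_axioms source_locale_map target_locale_map])
  then obtain l where l: "locale_map (fst R) (fst K) l"
      "\<forall>U\<in>carrier X. l (snd K (pr1 X X U)) = rel_source X R U"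
      "\<forall>U\<in>carrier X. l (snd K (pr2 X X U)) = rel_target X R U"
    using kernel_pair_pullback(3)[OF R.frame_axioms source_locale_map target_locale_map] by blast
  note u = XX.product_universal(4)[OF R.frame_axioms source_locale_map target_locale_map]
  have lk: "locale_map (fst R) (product X X) (l \<circ> snd K)"
    using frame_map_comp[OF sndK] l(1) by (simp add: locale_map_def)
  \<comment> \<open>Both sides are inverse images of maps from \<open>R\<close> to the product with
    components source and target, hence equal by uniqueness of pairings.\<close>
  have "l (snd K D) = snd R D" if D: "D \<in> carrier (product X X)" for D
    using u[OF lk _ _ D] u[OF snd_frame_map[folded locale_map_def] _ _ D] l(2,3)
    by (simp add: rel_source_def rel_target_def)
  then show thesis using that l(1) by (auto simp: sub_inclusion_def)
qed

section \<open>Density of the inclusion into the kernel pair\<close>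

text \<open>Density for a single rectangle. Replacing \<open>U\<close> by a saturated
  \<open>U'\<close> moves the condition on the first coordinate to the second, where it is disjoint
  from \<open>V\<close>.\<close>

lemma kernel_pair_disjoint:
  assumes U: "U \<in> carrier X" and V: "V \<in> carrier X"
    and dis: "rel_source X R U \<sqinter>\<^bsub>fst R\<^esub> rel_target X R V = \<bottom>\<^bsub>fst R\<^esub>"
  shows "snd K (pr1 X X U) \<sqinter>\<^bsub>fst K\<^esub> snd K (pr2 X X V) = \<bottom>\<^bsub>fst K\<^esub>"
proof -
  interpret K: frame "fst K" using kernel_pair_pullback(1) by (simp add: is_sublocale_def)
  have sndK: "frame_map (product X X) (fst K) (snd K)"
    using kernel_pair_pullback(1) by (simp add: is_sublocale_def locale_map_def)
  have k1: "frame_map X (fst K) (snd K \<circ> pr1 X X)" and k2: "frame_map X (fst K) (snd K \<circ> pr2 X X)"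
    using frame_map_comp[OF _ sndK] XX.locale_map_pr1 XX.locale_map_pr2 unfolding locale_map_def by blast+
  have kc: "snd K (pr1 X X A) \<in> carrier (fst K)" "snd K (pr2 X X A) \<in> carrier (fst K)"
    if "A \<in> carrier X" for A
    using frame_map_closed[OF k1 that] frame_map_closed[OF k2 that] by simp_all
  obtain U' where U': "U' \<in> carrier X" "U \<sqsubseteq>\<^bsub>X\<^esub> U'" "rel_source X R U' = rel_target X R U'"
      "U' \<sqinter>\<^bsub>X\<^esub> V = \<bottom>\<^bsub>X\<^esub>"
    using saturation[OF U] V dis by metis
  have "snd K (pr1 X X U) \<sqsubseteq>\<^bsub>fst K\<^esub> snd K (pr2 X X U')"
    using frame_map_mono[OF XX.X K.frame_axioms k1 U U'(1,2)] kernel_pair_eq[OF U'(1,3)] by simp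
  then have "snd K (pr1 X X U) \<sqinter>\<^bsub>fst K\<^esub> snd K (pr2 X X V) \<sqsubseteq>\<^bsub>fst K\<^esub>
      snd K (pr2 X X U') \<sqinter>\<^bsub>fst K\<^esub> snd K (pr2 X X V)"
    by (intro K.meet_mono kc U V U' K.le_refl)
  also have "snd K (pr2 X X U') \<sqinter>\<^bsub>fst K\<^esub> snd K (pr2 X X V) = snd K (pr2 X X (U' \<sqinter>\<^bsub>X\<^esub> V))"
    using frame_map_meet[OF k2 U'(1) V] by simp
  also have "\<dots> = \<bottom>\<^bsub>fst K\<^esub>"
    using frame_map_bottom[OF XX.X K.frame_axioms k2] U'(4) by simp
  finally show ?thesis by (intro K.le_bottom_eq K.meet_closed kc U V)
qed

text \<open>Every open of \<open>K\<close> is the restriction of some product open \<open>D\<close>.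
  Restriction to \<open>R\<close> and to \<open>K\<close> both expand as \<open>pairing\<close>, a
  join over the rectangles in \<open>D\<close>, so the question reduces to one rectangle at a
  time.\<close>

lemma kernel_pair_strongly_dense:
  assumes l: "sub_inclusion (product X X) R K l"
  shows "strongly_dense (fst R) (fst K) l"
  unfolding strongly_dense_def
proof
  fix p
  interpret K: frame "fst K" using kernel_pair_pullback(1) by (simp add: is_sublocale_def)
  have sndK: "frame_map (product X X) (fst K) (snd K)"
    using kernel_pair_pullback(1) by (simp add: is_sublocale_def locale_map_def)
  have k1: "locale_map (fst K) X (snd K \<circ> pr1 X X)" and k2: "locale_map (fst K) X (snd K \<circ> pr2 X X)"
    using frame_map_comp[OF _ sndK] XX.locale_map_pr1 XX.locale_map_pr2 unfolding locale_map_def by blast+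
  note sc = frame_map_closed[OF source_frame_map] and tc = frame_map_closed[OF target_frame_map]
  have lm: "locale_map (fst R) (fst K) l" using l by (simp add: sub_inclusion_def)
  have reflects: "V = \<bottom>\<^bsub>fst K\<^esub>" if V: "V \<in> carrier (fst K)" and lV: "l V \<sqsubseteq>\<^bsub>fst R\<^esub> \<bottom>\<^bsub>fst R\<^esub>" for V
  proof -
    obtain D where D: "D \<in> carrier (product X X)" and VD: "V = snd K D"
      using kernel_pair_pullback(1) V unfolding is_sublocale_def by (metis imageE)
    have Dsub: "D \<subseteq> carrier X \<times> carrier X"
      using D XX.product_open_subset by (simp add: XX.product_carrier)
    have RD: "snd R D = pairing (fst R) (rel_source X R) (rel_target X R) D"
      by (rule XX.product_universal(4)[OF R.frame_axioms source_locale_map target_locale_map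
            snd_frame_map[folded locale_map_def] _ _ D]) (simp_all add: rel_source_def rel_target_def)
    have KD: "V = pairing (fst K) (snd K \<circ> pr1 X X) (snd K \<circ> pr2 X X) D"
      unfolding VD
      by (rule XX.product_universal(4)[OF K.frame_axioms k1 k2 sndK[folded locale_map_def] _ _ D]) simp_all
    have "l V = snd R D" using l D VD by (simp add: sub_inclusion_def)
    then have RD_bot: "pairing (fst R) (rel_source X R) (rel_target X R) D = \<bottom>\<^bsub>fst R\<^esub>"
      using lV RD frame_map_closed[OF snd_frame_map D] R.le_bottom_eq by simp
    have "snd K (pr1 X X a) \<sqinter>\<^bsub>fst K\<^esub> snd K (pr2 X X b) = \<bottom>\<^bsub>fst K\<^esub>" if ab: "(a, b) \<in> D" for a b
    proof -
      have c: "a \<in> carrier X" "b \<in> carrier X" using ab Dsub by auto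
      let ?M = "{rel_source X R a \<sqinter>\<^bsub>fst R\<^esub> rel_target X R b | a b. (a, b) \<in> D}"
      have M: "?M \<subseteq> carrier (fst R)" using Dsub sc tc by auto
      \<comment> \<open>A join equal to bottom has only bottom members.\<close>
      have "rel_source X R a \<sqinter>\<^bsub>fst R\<^esub> rel_target X R b \<sqsubseteq>\<^bsub>fst R\<^esub> \<Squnion>\<^bsub>fst R\<^esub>?M"
        by (rule R.sup_upper[OF M]) (use ab in blast)
      then have "rel_source X R a \<sqinter>\<^bsub>fst R\<^esub> rel_target X R b = \<bottom>\<^bsub>fst R\<^esub>"
        using RD_bot R.le_bottom_eq[OF R.meet_closed[OF sc[OF c(1)] tc[OF c(2)]]]
        unfolding pairing_def by simp
      then show ?thesis by (rule kernel_pair_disjoint[OF c])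
    qed
    then show ?thesis
      unfolding KD pairing_def by (intro K.sup_eqI) auto
  qed
  show "direct_image (fst R) (fst K) l (terminal_map (fst R) p) \<sqsubseteq>\<^bsub>fst K\<^esub> terminal_map (fst K) p"
  \<comment> \<open>For \<open>True\<close> the bound is top. For \<open>False\<close> the direct
    image is the join of all \<open>V\<close> sent to bottom by \<open>l\<close>, and
    \<open>reflects\<close> makes each of them bottom.\<close>
  proof (cases p)
    case True
    have "direct_image (fst R) (fst K) l \<top>\<^bsub>fst R\<^esub> \<in> carrier (fst K)"
      by (rule direct_image_adjoint(2)[OF R.frame_axioms K.frame_axioms lm R.top_closed K.top_closed])
    then show ?thesis using True by (simp add: terminal_map_def K.top_higher)
  next
    case False
    have "direct_image (fst R) (fst K) l \<bottom>\<^bsub>fst R\<^esub> \<sqsubseteq>\<^bsub>fst K\<^esub> \<bottom>\<^bsub>fst K\<^esub>"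
      unfolding direct_image_def
    proof (rule K.sup_least)
      show "V \<sqsubseteq>\<^bsub>fst K\<^esub> \<bottom>\<^bsub>fst K\<^esub>" if "V \<in> {V \<in> carrier (fst K). l V \<sqsubseteq>\<^bsub>fst R\<^esub> \<bottom>\<^bsub>fst R\<^esub>}" for V
        using that reflects[of V] K.le_refl[OF K.bottom_closed] by simp
    qed auto
    then show ?thesis using False by (simp add: terminal_map_def)
  qed
qed

end

theorem corollary9p22:
  fixes X :: "'x gorder" and R :: "('x, 'r) locrel"
  assumes "frame X"
    and "localic_equivalence X R"
    and "open_cones X R"
    and "weakly_closed (product X X) R"
  shows "sub_eq (product X X) R (kernel_pair X (quotient_locale X R) (quotient_map X R))"
proof -
  interpret open_equivalence X R
    using assms(1-3) by (intro open_equivalence.intro open_equivalence_axioms.intro)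
  obtain l where l: "sub_inclusion (product X X) R K l" by (rule kernel_pair_inclusion)
  \<comment> \<open>\<open>K\<close> is built as an equaliser inside the product, so its opens have
    the type over which \<open>weakly_closed\<close> quantifies and the definition applies to it
    directly.\<close>
  have "locale_iso (fst R) (fst K) l"
    using assms(4) kernel_pair_pullback(1) l kernel_pair_strongly_dense[OF l]
    unfolding weakly_closed_def by blast
  then show ?thesis using l unfolding sub_eq_def by blast
qed

end
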